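(* Let $\gamma$ be a hedgehog of zero signed length. The iterated evolvents of $\gamma$ converge to the Steiner point of $\gamma$. The limiting shape of the iterated evolvents of $\gamma$ is a hypocycloid, generically, of order $2$.
   Context: A hedgehog is a cooriented closed plane wave front (a piecewise smooth curve, possibly with cusps, having a well-defined tangent line at every point) without inflections and with total turning $2\pi$. Its support function $p(\alpha)$ is the $2\pi$-periodic function giving the signed distance from the origin to the tangent line with coorienting vector $(\cos\alpha,\sin\alpha)$; the corresponding point of the curve is $(p\cos\alpha-p'\sin\alpha,\ p\sin\alpha+p'\cos\alpha)$. The evolute of a hedgehog is the envelope of its normal lines; its support function is $\alpha\mapsto p'(\alpha-\pi/2)$. An involute of $\gamma$ is a hedgehog whose evolute is $\gamma$. The signed length of a hedgehog is $\int_0^{2\pi}p\,d\alpha$ (the sign of the length element changes at each cusp). A hedgehog of zero signed length has a unique involute of zero signed length; this involute is called its evolvent, and the construction of the evolvent can be iterated. The Steiner point of $\gamma$ is $\frac1\pi\int_0^{2\pi}p(\alpha)(\cos\alpha,\sin\alpha)\,d\alpha$. A hypocycloid of order $m$ is a hedgehog whose support function, for a suitable choice of the origin, is a pure harmonic $a\cos m\alpha+b\sin m\alpha$ of order $m$. In speaking of the shape of curves, support functions (with the origin at the Steiner point) are considered up to a non-zero factor (dilation) and shift of the argument (rotation). *)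

theory Defs
  imports "HOL-Analysis.Analysis"
begin

text \<open>
  The plane is the type \<^typ>\<open>complex\<close>; the unit vector with angle \<open>\<alpha>\<close> is \<^term>\<open>cis \<alpha>\<close>.
  A front without inflections and of total turning \<open>2\<pi>\<close> has exactly one tangent line with each
  coorienting vector, so it is parametrised by the angle of that vector.  Cusps are
  points where the derivative vanishes or does not exist.
\<close>

definition hedgehog :: "(real \<Rightarrow> complex) \<Rightarrow> bool" where
  "hedgehog \<gamma> \<longleftrightarrow>
     (\<forall>\<alpha>. \<gamma> (\<alpha> + 2 * pi) = \<gamma> \<alpha>) \<and>
     \<gamma> piecewise_C1_differentiable_on {0..2 * pi} \<and>
     (\<forall>\<alpha>. \<gamma> differentiable (at \<alpha>) \<longrightarrow> vector_derivative \<gamma> (at \<alpha>) \<bullet> cis \<alpha> = 0)"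

definition tangent_line :: "(real \<Rightarrow> complex) \<Rightarrow> real \<Rightarrow> complex set" where
  "tangent_line \<gamma> \<alpha> = {z. (z - \<gamma> \<alpha>) \<bullet> cis \<alpha> = 0}"

definition normal_line :: "(real \<Rightarrow> complex) \<Rightarrow> real \<Rightarrow> complex set" where
  "normal_line \<gamma> \<alpha> = {\<gamma> \<alpha> + t *\<^sub>R cis \<alpha> | t. True}"

text \<open>The support function with respect to the origin \<open>c\<close>.\<close>

definition support_at :: "complex \<Rightarrow> (real \<Rightarrow> complex) \<Rightarrow> real \<Rightarrow> real" where
  "support_at c \<gamma> \<alpha> = (\<gamma> \<alpha> - c) \<bullet> cis \<alpha>"

abbreviation support :: "(real \<Rightarrow> complex) \<Rightarrow> real \<Rightarrow> real" where
  "support \<equiv> support_at 0"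

definition signed_length :: "(real \<Rightarrow> complex) \<Rightarrow> real" where
  "signed_length \<gamma> = integral {0..2 * pi} (support \<gamma>)"

definition steiner_point :: "(real \<Rightarrow> complex) \<Rightarrow> complex" where
  "steiner_point \<gamma> = (1 / pi) *\<^sub>R integral {0..2 * pi} (\<lambda>\<alpha>. support \<gamma> \<alpha> *\<^sub>R cis \<alpha>)"

definition zero_length_hedgehogs :: "(real \<Rightarrow> complex) set" where
  "zero_length_hedgehogs = {\<gamma>. hedgehog \<gamma> \<and> signed_length \<gamma> = 0}"

text \<open>
  The evolute is the hedgehog enveloped by the normal lines.  The normal at the point with angle
  \<open>\<alpha>\<close> is cooriented by \<^term>\<open>cis (\<alpha> + pi / 2)\<close>; lemma \<open>support_evolute\<close> below gives the resulting
  support function.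
\<close>

definition is_evolute :: "(real \<Rightarrow> complex) \<Rightarrow> (real \<Rightarrow> complex) \<Rightarrow> bool" where
  "is_evolute \<delta> \<gamma> \<longleftrightarrow>
     hedgehog \<delta> \<and> (\<forall>\<alpha>. tangent_line \<delta> (\<alpha> + pi / 2) = normal_line \<gamma> \<alpha>)"

definition is_involute :: "(real \<Rightarrow> complex) \<Rightarrow> (real \<Rightarrow> complex) \<Rightarrow> bool" where
  "is_involute \<sigma> \<gamma> \<longleftrightarrow> hedgehog \<sigma> \<and> is_evolute \<gamma> \<sigma>"

text \<open>Well defined on hedgehogs of zero signed length, see lemma \<open>ex1_evolvent\<close> below.\<close>

definition evolvent :: "(real \<Rightarrow> complex) \<Rightarrow> (real \<Rightarrow> complex)" where
  "evolvent \<gamma> = (THE \<sigma>. is_involute \<sigma> \<gamma> \<and> signed_length \<sigma> = 0)"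

definition hypocycloid :: "nat \<Rightarrow> (real \<Rightarrow> complex) \<Rightarrow> bool" where
  "hypocycloid m \<gamma> \<longleftrightarrow> hedgehog \<gamma> \<and>
     (\<exists>c a b. (a, b) \<noteq> (0, 0) \<and>
        (\<forall>\<alpha>. support_at c \<gamma> \<alpha> = a * cos (real m * \<alpha>) + b * sin (real m * \<alpha>)))"

definition is_point :: "(real \<Rightarrow> complex) \<Rightarrow> bool" where
  "is_point \<gamma> \<longleftrightarrow> (\<exists>c. \<forall>\<alpha>. \<gamma> \<alpha> = c)"

text \<open>
  The shape of a hedgehog is its support function with respect to the Steiner point, up to a
  non-zero factor and a shift of the argument; a single point has no shape.  Shapes converge if
  suitable representatives converge uniformly with all derivatives.  (The \<open>k\<close>-th iterated
  evolvent has a support function of class at least \<open>C\<^sup>k\<close>, so that each derivative of order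
  \<open>j\<close> exists from some index on.)
\<close>

definition limiting_shape :: "(nat \<Rightarrow> real \<Rightarrow> complex) \<Rightarrow> (real \<Rightarrow> complex) \<Rightarrow> bool" where
  "limiting_shape \<sigma> \<delta> \<longleftrightarrow> hedgehog \<delta> \<and> \<not> is_point \<delta> \<and>
     (\<exists>c \<theta> :: nat \<Rightarrow> real. (\<forall>k. c k \<noteq> 0) \<and>
        (\<forall>j. uniform_limit UNIV
           (\<lambda>k. (deriv ^^ j)
              (\<lambda>\<alpha>. c k * support_at (steiner_point (\<sigma> k)) (\<sigma> k) (\<alpha> + \<theta> k)))
           ((deriv ^^ j) (support_at (steiner_point \<delta>) \<delta>))
           sequentially))"

text \<open>The limiting shape of the iterated evolvents exists and is a hypocycloid of order \<open>m\<close>.\<close>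

definition evolvents_limit_order :: "nat \<Rightarrow> (real \<Rightarrow> complex) \<Rightarrow> bool" where
  "evolvents_limit_order m \<gamma> \<longleftrightarrow>
     (\<exists>\<delta>. limiting_shape (\<lambda>k. (evolvent ^^ k) \<gamma>) \<delta>) \<and>
     (\<forall>\<delta>. limiting_shape (\<lambda>k. (evolvent ^^ k) \<gamma>) \<delta> \<longrightarrow> hypocycloid m \<delta>)"

text \<open>
  A generic property of hedgehogs of zero signed length: the set of hedgehogs having it is open in
  the \<open>C\<^sup>0\<close> topology on support functions, hence in every finer one, and dense in every \<open>C\<^sup>r\<close>
  topology.  The approximating support functions differ from the given one by a smooth function, so
  that density also holds within the hedgehogs with smooth support function.
\<close>

definition generically :: "((real \<Rightarrow> complex) \<Rightarrow> bool) \<Rightarrow> bool" where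
  "generically P \<longleftrightarrow>
     (\<forall>\<gamma>\<in>zero_length_hedgehogs. P \<gamma> \<longrightarrow>
        (\<exists>\<epsilon>>0. \<forall>\<gamma>'\<in>zero_length_hedgehogs.
           (\<forall>\<alpha>. \<bar>support \<gamma>' \<alpha> - support \<gamma> \<alpha>\<bar> < \<epsilon>) \<longrightarrow> P \<gamma>')) \<and>
     (\<forall>\<gamma>\<in>zero_length_hedgehogs. \<forall>r::nat. \<forall>\<epsilon>>0. \<exists>\<gamma>'\<in>zero_length_hedgehogs. P \<gamma>' \<and>
        (\<forall>j. (deriv ^^ j) (\<lambda>\<alpha>. support \<gamma>' \<alpha> - support \<gamma> \<alpha>) differentiable_on UNIV) \<and>
        (\<forall>j\<le>r. \<forall>\<alpha>. \<bar>(deriv ^^ j) (\<lambda>\<alpha>. support \<gamma>' \<alpha> - support \<gamma> \<alpha>) \<alpha>\<bar> < \<epsilon>))"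

subsection \<open>Consistency with the formulas for support functions\<close>

lemma inner_cis [simp]: "z \<bullet> cis x = Re z * cos x + Im z * sin x"
  by (simp add: inner_complex_def)

lemma cis_decomp: "z = (z \<bullet> cis x) *\<^sub>R cis x + (z \<bullet> cis (x + pi / 2)) *\<^sub>R cis (x + pi / 2)"
proof -
  have 1: "a = (a * c + b * s) * c + (a * s - b * c) * s"
    and 2: "b = (a * c + b * s) * s - (a * s - b * c) * c" if "c\<^sup>2 + s\<^sup>2 = 1" for a b c s :: real
    using that by algebra+
  show ?thesis
    using 1[OF sin_cos_squared_add2[of x], of "Re z" "Im z"]
      2[OF sin_cos_squared_add2[of x], of "Im z" "Re z"]
    by (simp add: complex_eq_iff cos_add sin_add algebra_simps)
qed

lemma hedgehog_periodic: "hedgehog \<gamma> \<Longrightarrow> \<gamma> (x + 2 * pi) = \<gamma> x"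
  by (simp add: hedgehog_def)

lemma hedgehog_regularity:
  assumes "hedgehog \<gamma>"
  obtains E where "finite E" "continuous_on {- 2 * pi..4 * pi} \<gamma>"
    "\<And>x. x \<in> {- 2 * pi..4 * pi} - E \<Longrightarrow> \<gamma> differentiable (at x)"
proof -
  obtain S where S: "finite S" "continuous_on {0..2 * pi} \<gamma>" "\<gamma> C1_differentiable_on ({0..2 * pi} - S)"
    using assms unfolding hedgehog_def piecewise_C1_differentiable_on_def by blast
  have per: "\<gamma> (x - 2 * pi) = \<gamma> x" "\<gamma> (x + 2 * pi) = \<gamma> x" for x
    using hedgehog_periodic[OF assms, of x] hedgehog_periodic[OF assms, of "x - 2 * pi"] by auto
  have d: "\<gamma> differentiable (at x)" if "x \<in> {0..2 * pi} - S" for x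
    using S(3) that unfolding C1_differentiable_on_def differentiable_def has_vector_derivative_def by blast
  have shift: "\<gamma> differentiable (at x)" if "\<gamma> differentiable (at (x + a))" "\<And>y. \<gamma> (y + a) = \<gamma> y" for x a
  proof -
    have "(\<gamma> \<circ> (\<lambda>y. y + a)) differentiable (at x)"
      by (rule differentiable_chain_at) (use that in auto)
    then show ?thesis using that(2) by (simp add: o_def)
  qed
  have cshift: "continuous_on ((\<lambda>y. y - a) ` {0..2 * pi}) \<gamma>" if "\<And>y. \<gamma> (y + a) = \<gamma> y" for a
  proof -
    have "continuous_on ((\<lambda>y. y - a) ` {0..2 * pi}) (\<gamma> \<circ> (\<lambda>y. y + a))"
      by (rule continuous_on_compose) (auto intro!: continuous_intros simp: image_image S(2))
    then show ?thesis using that by (simp add: o_def)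
  qed
  define E where "E = S \<union> (\<lambda>y. y - 2 * pi) ` S \<union> (\<lambda>y. y + 2 * pi) ` S"
  have "continuous_on {- 2 * pi..0} \<gamma>" "continuous_on {2 * pi..4 * pi} \<gamma>"
    using cshift[of "2 * pi"] cshift[of "- 2 * pi"] per by simp_all
  then have "continuous_on ({- 2 * pi..0} \<union> {0..2 * pi} \<union> {2 * pi..4 * pi}) \<gamma>"
    using S(2) by (intro continuous_on_closed_Un closed_Un closed_real_atLeastAtMost)
  moreover have "{- 2 * pi..0} \<union> {0..2 * pi} \<union> {2 * pi..4 * pi} = {- 2 * pi..4 * pi}" by auto
  ultimately have "continuous_on {- 2 * pi..4 * pi} \<gamma>" by simp
  moreover have "\<gamma> differentiable (at x)" if x: "x \<in> {- 2 * pi..4 * pi} - E" for x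
  proof -
    have "x \<notin> S" "x + 2 * pi \<notin> S" "x - 2 * pi \<notin> S"
      using x by (force simp: E_def)+
    moreover have "x \<in> {0..2 * pi} \<or> x + 2 * pi \<in> {0..2 * pi} \<or> x - 2 * pi \<in> {0..2 * pi}"
      using x by force
    ultimately show ?thesis
      using d[of x] d[of "x + 2 * pi"] d[of "x - 2 * pi"]
        shift[of x "2 * pi"] shift[of x "- 2 * pi"] per by auto
  qed
  moreover have "finite E" using S(1) by (simp add: E_def)
  ultimately show ?thesis using that by blast
qed

lemma support_has_derivative:
  assumes "hedgehog \<gamma>"
  shows "(support \<gamma> has_real_derivative \<gamma> \<alpha> \<bullet> cis (\<alpha> + pi / 2)) (at \<alpha>)"
proof -
  have base: "(support \<gamma> has_real_derivative \<gamma> x \<bullet> cis (x + pi / 2)) (at x)" if x: "x \<in> {0..<2 * pi}" for x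
  proof -
    obtain E where E: "finite E" "continuous_on {- 2 * pi..4 * pi} \<gamma>"
      "\<And>x. x \<in> {- 2 * pi..4 * pi} - E \<Longrightarrow> \<gamma> differentiable (at x)"
      using hedgehog_regularity[OF assms] by blast
    let ?g = "\<lambda>y. \<gamma> y \<bullet> cis (y + pi / 2)"
    have cont: "continuous_on {- 2 * pi..4 * pi} ?g" "continuous_on {- 2 * pi..4 * pi} (support \<gamma>)"
      using E(2) by (auto simp: support_at_def intro!: continuous_intros)
    have der: "(support \<gamma> has_vector_derivative ?g y) (at y)" if "y \<in> {- 2 * pi..4 * pi} - E" for y
    proof -
      let ?v = "vector_derivative \<gamma> (at y)"
      have v: "(\<gamma> has_vector_derivative ?v) (at y)" and "?v \<bullet> cis y = 0"
        using E(3)[OF that] assms by (auto simp: vector_derivative_works hedgehog_def)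
      have re: "((\<lambda>y. Re (\<gamma> y)) has_real_derivative Re ?v) (at y)"
         and im: "((\<lambda>y. Im (\<gamma> y)) has_real_derivative Im ?v) (at y)"
        using v by (auto simp: has_vector_derivative_complex_iff)
      then have "((\<lambda>y. Re (\<gamma> y) * cos y + Im (\<gamma> y) * sin y) has_real_derivative ?g y) (at y)"
        using \<open>?v \<bullet> cis y = 0\<close> re im
        by - (rule derivative_eq_intros re im refl | simp add: cos_add sin_add algebra_simps)+
      then show ?thesis
        by (simp add: support_at_def[abs_def] has_real_derivative_iff_has_vector_derivative)
    qed
    have int: "integral {- 2 * pi..y} ?g = support \<gamma> y - support \<gamma> (- 2 * pi)"
      if "y \<in> {- 2 * pi..4 * pi}" for y
      by (intro integral_unique fundamental_theorem_of_calculus_strong[OF E(1)] der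
            continuous_on_subset[OF cont(2)]) (use that in auto)
    have "((\<lambda>y. integral {- 2 * pi..y} ?g) has_real_derivative ?g x) (at x within {- 2 * pi..4 * pi})"
      by (rule integral_has_real_derivative[OF cont(1)]) (use x pi_gt_zero in \<open>auto intro: order.trans[of _ 0]\<close>)
    then have "((\<lambda>y. support \<gamma> y - support \<gamma> (- 2 * pi)) has_real_derivative ?g x) (at x within {- 2 * pi..4 * pi})"
      by (rule has_field_derivative_transform_within[OF _ zero_less_one]) (use x int in auto)
    then have "((\<lambda>y. (support \<gamma> y - support \<gamma> (- 2 * pi)) + support \<gamma> (- 2 * pi)) has_real_derivative ?g x + 0)
        (at x within {- 2 * pi..4 * pi})"
      by (intro DERIV_add) auto
    moreover have "x \<in> interior {- 2 * pi..4 * pi}"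
      using x pi_gt_zero unfolding interior_atLeastAtMost_real greaterThanLessThan_iff atLeastLessThan_iff by linarith
    ultimately show ?thesis
      unfolding at_within_interior[OF \<open>x \<in> interior {- 2 * pi..4 * pi}\<close>] diff_add_cancel add_0_right
      by (simp only:)
  qed
  define n where "n = \<lfloor>\<alpha> / (2 * pi)\<rfloor>"
  define a where "a = 2 * pi * of_int n"
  have per: "\<gamma> (y - 2 * pi * of_int k) = \<gamma> y" for y k
  proof (induction k rule: int_induct[where k = 0])
    case (step1 i)
    then show ?case
      using hedgehog_periodic[OF assms, of "y - 2 * pi * of_int (i + 1)"] by (simp add: algebra_simps)
  next
    case (step2 i)
    then show ?case
      using hedgehog_periodic[OF assms, of "y - 2 * pi * of_int i"] by (simp add: algebra_simps)
  qed auto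
  have cs: "cos (y - a) = cos y" "sin (y - a) = sin y" for y
    by (simp_all add: a_def cos_diff sin_diff)
  have "\<alpha> - a \<in> {0..<2 * pi}"
    using floor_divide_lower[of "2 * pi" \<alpha>] floor_divide_upper[of "2 * pi" \<alpha>]
    by (simp add: a_def n_def algebra_simps)
  from base[OF this] have "(support \<gamma> has_real_derivative
       \<gamma> (\<alpha> - a) \<bullet> cis (\<alpha> - a + pi / 2)) (at (\<alpha> + - a))"
    by (simp only: diff_conv_add_uminus)
  then have "((\<lambda>y. support \<gamma> (y + - a)) has_real_derivative
       \<gamma> (\<alpha> - a) \<bullet> cis (\<alpha> - a + pi / 2)) (at \<alpha>)"
    unfolding DERIV_shift .
  then show ?thesis
    using per[of _ n] cs
    by (simp add: support_at_def[abs_def] a_def[symmetric] cos_add sin_add)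
qed

lemma hedgehog_eq:
  assumes "hedgehog \<gamma>"
  defines "p \<equiv> support \<gamma>"
  shows "\<gamma> \<alpha> = Complex (p \<alpha> * cos \<alpha> - deriv p \<alpha> * sin \<alpha>) (p \<alpha> * sin \<alpha> + deriv p \<alpha> * cos \<alpha>)"
proof -
  have "deriv p \<alpha> = \<gamma> \<alpha> \<bullet> cis (\<alpha> + pi / 2)"
    unfolding p_def by (rule DERIV_imp_deriv[OF support_has_derivative[OF assms(1)]])
  then have "\<gamma> \<alpha> = p \<alpha> *\<^sub>R cis \<alpha> + deriv p \<alpha> *\<^sub>R cis (\<alpha> + pi / 2)"
    using cis_decomp[of "\<gamma> \<alpha>" \<alpha>] by (simp add: p_def support_at_def del: inner_cis)
  then show ?thesis
    by (simp add: complex_eq_iff cos_add sin_add algebra_simps)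
qed

lemma is_evolute_iff:
  "is_evolute \<delta> \<gamma> \<longleftrightarrow> hedgehog \<delta> \<and> (\<forall>\<alpha>. support \<delta> (\<alpha> + pi / 2) = \<gamma> \<alpha> \<bullet> cis (\<alpha> + pi / 2))"
proof -
  have "tangent_line \<delta> (\<alpha> + pi / 2) = normal_line \<gamma> \<alpha> \<longleftrightarrow>
      support \<delta> (\<alpha> + pi / 2) = \<gamma> \<alpha> \<bullet> cis (\<alpha> + pi / 2)" (is "?l \<longleftrightarrow> ?r") for \<alpha>
  proof
    assume ?l
    moreover have "\<gamma> \<alpha> + 0 *\<^sub>R cis \<alpha> \<in> normal_line \<gamma> \<alpha>"
      unfolding normal_line_def by blast
    ultimately have "\<gamma> \<alpha> \<in> tangent_line \<delta> (\<alpha> + pi / 2)"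
      by simp
    then show ?r
      by (simp add: tangent_line_def support_at_def algebra_simps)
  next
    assume r: ?r
    have "z \<in> tangent_line \<delta> (\<alpha> + pi / 2) \<longleftrightarrow> z \<in> normal_line \<gamma> \<alpha>" for z
    proof
      assume "z \<in> tangent_line \<delta> (\<alpha> + pi / 2)"
      with r have "(z - \<gamma> \<alpha>) \<bullet> cis (\<alpha> + pi / 2) = 0"
        by (simp add: tangent_line_def support_at_def algebra_simps)
      with cis_decomp[of "z - \<gamma> \<alpha>" \<alpha>] have "z = \<gamma> \<alpha> + ((z - \<gamma> \<alpha>) \<bullet> cis \<alpha>) *\<^sub>R cis \<alpha>"
        by (simp add: algebra_simps del: inner_cis)
      then show "z \<in> normal_line \<gamma> \<alpha>" unfolding normal_line_def by blast
    next
      assume "z \<in> normal_line \<gamma> \<alpha>"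
      then show "z \<in> tangent_line \<delta> (\<alpha> + pi / 2)"
        using r by (auto simp: normal_line_def tangent_line_def support_at_def cos_add sin_add algebra_simps)
    qed
    then show ?l by blast
  qed
  then show ?thesis by (simp add: is_evolute_def)
qed

lemma support_evolute:
  assumes "hedgehog \<gamma>" "is_evolute \<delta> \<gamma>"
  shows "support \<delta> \<alpha> = deriv (support \<gamma>) (\<alpha> - pi / 2)"
proof -
  have "support \<delta> ((\<alpha> - pi / 2) + pi / 2) = \<gamma> (\<alpha> - pi / 2) \<bullet> cis ((\<alpha> - pi / 2) + pi / 2)"
    using assms(2) unfolding is_evolute_iff by blast
  then show ?thesis
    using DERIV_imp_deriv[OF support_has_derivative[OF assms(1), of "\<alpha> - pi / 2"]] by simp
qed

lemma support_periodic: "hedgehog \<gamma> \<Longrightarrow> support \<gamma> (x + 2 * pi) = support \<gamma> x"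
  by (simp add: support_at_def hedgehog_periodic)

lemma support_continuous: "hedgehog \<gamma> \<Longrightarrow> continuous_on S (support \<gamma>)"
  by (meson DERIV_continuous_on has_field_derivative_at_within support_has_derivative)

lemma ex1_evolvent:
  assumes "hedgehog \<gamma>" "signed_length \<gamma> = 0"
  shows "\<exists>!\<sigma>. is_involute \<sigma> \<gamma> \<and> signed_length \<sigma> = 0"
proof -
  have inv_iff: "is_involute \<sigma> \<gamma> \<longleftrightarrow>
      hedgehog \<sigma> \<and> (\<forall>\<alpha>. support \<gamma> (\<alpha> + pi / 2) = \<sigma> \<alpha> \<bullet> cis (\<alpha> + pi / 2))" for \<sigma>
    using assms(1) by (auto simp: is_involute_def is_evolute_iff)
  have const: "f x = f 0" if "\<And>x. (f has_real_derivative 0) (at x)" for f :: "real \<Rightarrow> real" and x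
    using DERIV_isconst_all[of f x 0] that by blast
  have "isCont (support \<gamma>) x" for x
    using DERIV_isCont[OF support_has_derivative[OF assms(1)]] .
  then obtain G where G: "(G has_real_derivative support \<gamma> x) (at x)" for x
    using einterval_antiderivative[of "- \<infinity>" \<infinity> "support \<gamma>"]
    by (auto simp: has_real_derivative_iff_has_vector_derivative)
  have "(support \<gamma> has_integral (G (2 * pi) - G 0)) {0..2 * pi}"
    by (rule fundamental_theorem_of_calculus)
       (auto simp: G has_real_derivative_iff_has_vector_derivative[symmetric] has_field_derivative_at_within)
  then have G0: "G (2 * pi) = G 0"
    using assms(2) by (simp add: signed_length_def integral_unique)
  have Gper: "G (x + 2 * pi) = G x" for x
  proof -
    have "((\<lambda>x. G (x + 2 * pi) - G x) has_real_derivative 0) (at x)" for x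
      using DERIV_diff[OF _ G, of "\<lambda>x. G (x + 2 * pi)" "support \<gamma> x" x] G[of "x + 2 * pi"]
      by (simp add: DERIV_shift support_periodic[OF assms(1)])
    from const[OF this, of x] G0 show ?thesis by simp
  qed
  define m where "m = integral {0..2 * pi} (\<lambda>\<alpha>. G (\<alpha> + pi / 2)) / (2 * pi)"
  define q where "q \<alpha> = G (\<alpha> + pi / 2) - m" for \<alpha>
  have q: "(q has_real_derivative support \<gamma> (\<alpha> + pi / 2)) (at \<alpha>)" for \<alpha>
    using G[of "\<alpha> + pi / 2"] by (auto simp: q_def[abs_def] DERIV_shift intro!: derivative_eq_intros)
  define \<sigma> where "\<sigma> \<alpha> = q \<alpha> *\<^sub>R cis \<alpha> + support \<gamma> (\<alpha> + pi / 2) *\<^sub>R cis (\<alpha> + pi / 2)" for \<alpha>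
  define D where "D \<alpha> = (q \<alpha> + \<gamma> (\<alpha> + pi / 2) \<bullet> cis (\<alpha> + pi / 2 + pi / 2)) *\<^sub>R cis (\<alpha> + pi / 2)" for \<alpha>
  have D: "(\<sigma> has_vector_derivative D \<alpha>) (at \<alpha>)" for \<alpha>
  proof -
    have p: "((\<lambda>\<alpha>. support \<gamma> (\<alpha> + pi / 2)) has_real_derivative
        \<gamma> (\<alpha> + pi / 2) \<bullet> cis (\<alpha> + pi / 2 + pi / 2)) (at \<alpha>)"
      using support_has_derivative[OF assms(1), of "\<alpha> + pi / 2"] unfolding DERIV_shift .
    have c: "(cis has_vector_derivative cis (x + pi / 2)) (at x)" for x
      by (auto simp: has_vector_derivative_complex_iff cos_add sin_add intro!: derivative_eq_intros)
    have c': "((\<lambda>\<alpha>. cis (\<alpha> + pi / 2)) has_vector_derivative cis (\<alpha> + pi / 2 + pi / 2)) (at \<alpha>)"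
      by (auto simp: has_vector_derivative_complex_iff cos_add sin_add intro!: derivative_eq_intros)
    have "cis (\<alpha> + pi / 2 + pi / 2) = - cis \<alpha>"
      by (simp add: complex_eq_iff cos_add sin_add)
    then show ?thesis
      using has_vector_derivative_add[OF has_vector_derivative_scaleR[OF q[of \<alpha>] c[of \<alpha>]]
          has_vector_derivative_scaleR[OF p c']]
      unfolding \<sigma>_def[abs_def] D_def by (simp add: algebra_simps del: inner_cis)
  qed
  have orth: "cis (\<alpha> + pi / 2) \<bullet> cis \<alpha> = 0" "cis \<alpha> \<bullet> cis (\<alpha> + pi / 2) = 0"
    "cis \<alpha> \<bullet> cis \<alpha> = 1" for \<alpha>
    by (auto simp: cos_add sin_add simp flip: power2_eq_square)
  have supp: "support \<sigma> = q"
    by (auto simp: support_at_def fun_eq_iff \<sigma>_def inner_add_left orth simp del: inner_cis)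
  have contD: "continuous_on {0..2 * pi} D"
  proof -
    obtain E where E: "continuous_on {- 2 * pi..4 * pi} \<gamma>"
      using hedgehog_regularity[OF assms(1)] by blast
    have "continuous_on {0..2 * pi} (\<gamma> \<circ> (\<lambda>\<alpha>. \<alpha> + pi / 2))"
      by (intro continuous_on_compose continuous_intros continuous_on_subset[OF E]) auto
    moreover have "continuous_on {0..2 * pi} q"
      using q by (meson DERIV_continuous_on has_field_derivative_at_within)
    ultimately show ?thesis
      by (auto simp: D_def[abs_def] o_def intro!: continuous_intros simp del: inner_cis)
  qed
  have "hedgehog \<sigma>"
    unfolding hedgehog_def
  proof (intro conjI allI impI)
    have "\<alpha> + 2 * pi + pi / 2 = (\<alpha> + pi / 2) + 2 * pi" "cis (\<alpha> + 2 * pi) = cis \<alpha>" for \<alpha> :: real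
      by (simp_all add: complex_eq_iff)
    then show "\<sigma> (\<alpha> + 2 * pi) = \<sigma> \<alpha>" for \<alpha>
      using support_periodic[OF assms(1), of "\<alpha> + pi / 2"] Gper[of "\<alpha> + pi / 2"]
      by (simp only: \<sigma>_def q_def)
    show "\<sigma> piecewise_C1_differentiable_on {0..2 * pi}"
      by (rule C1_differentiable_imp_piecewise) (use D contD in \<open>auto simp: C1_differentiable_on_def\<close>)
    show "vector_derivative \<sigma> (at \<alpha>) \<bullet> cis \<alpha> = 0" for \<alpha>
      unfolding vector_derivative_at[OF D] by (simp add: D_def orth del: inner_cis)
  qed
  moreover have "support \<gamma> (\<alpha> + pi / 2) = \<sigma> \<alpha> \<bullet> cis (\<alpha> + pi / 2)" for \<alpha>
    by (simp add: \<sigma>_def inner_add_left orth del: inner_cis)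
  moreover have "signed_length \<sigma> = 0"
  proof -
    have "continuous_on {0..2 * pi} (\<lambda>\<alpha>. G (\<alpha> + pi / 2))"
    proof (intro continuous_at_imp_continuous_on ballI DERIV_isCont)
      show "((\<lambda>\<alpha>. G (\<alpha> + pi / 2)) has_real_derivative support \<gamma> (x + pi / 2)) (at x)" for x
        using G[of "x + pi / 2"] unfolding DERIV_shift .
    qed
    then have "integral {0..2 * pi} q = 0"
      unfolding q_def[abs_def]
      by (subst integral_diff) (auto intro: integrable_continuous_real simp: m_def)
    then show ?thesis by (simp add: signed_length_def supp)
  qed
  ultimately have ex: "is_involute \<sigma> \<gamma> \<and> signed_length \<sigma> = 0"
    by (simp add: inv_iff del: inner_cis)
  have "\<tau> = \<sigma>" if \<tau>: "is_involute \<tau> \<gamma> \<and> signed_length \<tau> = 0" for \<tau>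
  proof -
    have h: "hedgehog \<tau>" "hedgehog \<sigma>" using \<tau> ex by (auto simp: is_involute_def)
    have eq: "\<tau> \<alpha> \<bullet> cis (\<alpha> + pi / 2) = \<sigma> \<alpha> \<bullet> cis (\<alpha> + pi / 2)" for \<alpha>
      using \<tau> ex by (metis inv_iff)
    have "((\<lambda>\<alpha>. support \<tau> \<alpha> - support \<sigma> \<alpha>) has_real_derivative 0) (at x)" for x
      using DERIV_diff[OF support_has_derivative[OF h(1)] support_has_derivative[OF h(2)], of x]
      by (simp only: eq diff_self)
    then obtain c where c: "support \<tau> \<alpha> = support \<sigma> \<alpha> + c" for \<alpha>
      using const[of "\<lambda>\<alpha>. support \<tau> \<alpha> - support \<sigma> \<alpha>"] by (metis diff_add_cancel add.commute)
    have "signed_length \<tau> = signed_length \<sigma> + 2 * pi * c"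
      unfolding signed_length_def c[abs_def]
      by (subst integral_add) (auto intro: integrable_continuous_real support_continuous h)
    then have "c = 0" using \<tau> ex by simp
    have "\<tau> \<alpha> = \<sigma> \<alpha>" for \<alpha>
      using cis_decomp[of "\<tau> \<alpha>" \<alpha>] cis_decomp[of "\<sigma> \<alpha>" \<alpha>] eq[of \<alpha>] c[of \<alpha>] \<open>c = 0\<close>
      by (simp add: support_at_def del: inner_cis)
    then show ?thesis by blast
  qed
  with ex show ?thesis by blast
qed

declare inner_cis [simp del]

end

theory Submission imports Defs
begin

text \<open>
  Measured from the Steiner point, the supports \<open>f\<^sub>k\<close> of the iterated evolvents satisfy
  \<open>f\<^sub>k\<^sub>+\<^sub>1' = f\<^sub>k(\<cdot> + \<pi>/2)\<close>.  Hence the \<open>n\<close>-th Fourier coefficient is divided by \<open>n\<close> and rotated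
  at each step, while those of order \<open>0\<close> and \<open>1\<close> vanish.  If \<open>m\<close> is the lowest order present in
  \<open>f\<^sub>0\<close>, then \<open>m\<^sup>k f\<^sub>k\<close>, suitably rotated, differs from that harmonic by
  \<open>O((m / (m + 1))\<^sup>k)\<close>.  Differentiation only lowers the index \<open>k\<close> and shifts the argument, so that
  the convergence extends to all derivatives.  Order \<open>m = 2\<close> occurs exactly when the second Fourier
  coefficient is non-zero, an open and dense condition.
\<close>

subsection \<open>Fourier series of continuous periodic functions\<close>

text \<open>Of the initial Fourier coefficients only boundedness is known. Those of
  \<open>f k\<close> carry the extra factor \<open>1 / n ^ k\<close>, so the series is absolutely
  convergent from k = 2 on, and only there is it used to represent the function. That it does
  represent it rests on uniqueness of Fourier coefficients, obtained from Stone-Weierstrass on the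
  unit circle. The order 0 coefficient is the signed length; the order 1 coefficient is the
  conjugate of the Steiner point times \<open>pi\<close>. The step to the evolvent multiplies order
  1 by 1, so the Steiner point never moves and one origin serves all k. A further obstacle is that a
  limiting shape may be reached with arbitrary factors and rotations. Absolute values of Fourier
  coefficients are blind to the rotations, and comparing two orders eliminates the factors, so every
  limit is forced to be a harmonic of order m.\<close>

definition cont_periodic :: "(real \<Rightarrow> 'a::real_normed_vector) \<Rightarrow> bool" where
  "cont_periodic f \<longleftrightarrow> continuous_on UNIV f \<and> (\<forall>x. f (x + 2 * pi) = f x)"

lemma cont_periodicI:
  "continuous_on UNIV f \<Longrightarrow> (\<And>x. f (x + 2 * pi) = f x) \<Longrightarrow> cont_periodic f"
  by (simp add: cont_periodic_def)

lemma cont_periodic_continuous: "cont_periodic f \<Longrightarrow> continuous_on S f"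
  by (auto simp: cont_periodic_def intro: continuous_on_subset)

lemma cont_periodic_eq: "cont_periodic f \<Longrightarrow> f (x + 2 * pi) = f x"
  by (simp add: cont_periodic_def)

lemma cont_periodic_shift: "cont_periodic f \<Longrightarrow> cont_periodic (\<lambda>x. f (x + t))"
proof (rule cont_periodicI)
  assume f: "cont_periodic f"
  show "continuous_on UNIV (\<lambda>x. f (x + t))"
    by (rule continuous_on_compose2[OF cont_periodic_continuous[OF f, of UNIV]])
       (auto intro!: continuous_intros)
  show "f (x + 2 * pi + t) = f (x + t)" for x
    using cont_periodic_eq[OF f, of "x + t"] by (simp add: algebra_simps)
qed

lemma cont_periodic_cis:
  assumes "n \<in> \<int>"
  shows "cont_periodic (\<lambda>x. cis (n * x))"
proof (rule cont_periodicI)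
  show "continuous_on UNIV (\<lambda>x. cis (n * x))"
    by (intro continuous_intros)
  show "cis (n * (x + 2 * pi)) = cis (n * x)" for x
    using assms by (simp add: distrib_left mult.commute[of n "2 * pi"] flip: cis_mult)
qed

lemma cont_periodic_scaleR:
  "cont_periodic f \<Longrightarrow> cont_periodic g \<Longrightarrow> cont_periodic (\<lambda>x. f x *\<^sub>R g x)"
  unfolding cont_periodic_def by (auto intro!: continuous_intros)

lemma cont_periodic_mult:
  fixes f g :: "real \<Rightarrow> 'a::real_normed_algebra"
  shows "cont_periodic f \<Longrightarrow> cont_periodic g \<Longrightarrow> cont_periodic (\<lambda>x. f x * g x)"
  unfolding cont_periodic_def by (auto intro!: continuous_intros)

lemma cont_periodic_add:
  "cont_periodic f \<Longrightarrow> cont_periodic g \<Longrightarrow> cont_periodic (\<lambda>x. f x + g x)"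
  unfolding cont_periodic_def by (auto intro!: continuous_intros)

lemma cont_periodic_diff:
  "cont_periodic f \<Longrightarrow> cont_periodic g \<Longrightarrow> cont_periodic (\<lambda>x. f x - g x)"
  unfolding cont_periodic_def by (auto intro!: continuous_intros)

lemma cont_periodic_const: "cont_periodic (\<lambda>x. c)"
  unfolding cont_periodic_def by auto

lemma cont_periodic_Re: "cont_periodic f \<Longrightarrow> cont_periodic (\<lambda>x. Re (f x))"
  unfolding cont_periodic_def by (auto intro!: continuous_intros)

lemma cont_periodic_integrable:
  fixes f :: "real \<Rightarrow> 'a::banach"
  shows "cont_periodic f \<Longrightarrow> f integrable_on {a..b}"
  by (intro integrable_continuous_real cont_periodic_continuous)

lemma periodic_of_int:
  fixes f :: "real \<Rightarrow> 'a"
  assumes "\<And>x. f (x + 2 * pi) = f x"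
  shows "f (x + 2 * pi * of_int n) = f x"
proof (induction n rule: int_induct[where k = 0])
  case (step1 i)
  then show ?case using assms[of "x + 2 * pi * of_int i"] by (simp add: algebra_simps)
next
  case (step2 i)
  then show ?case using assms[of "x + 2 * pi * of_int (i - 1)"] by (simp add: algebra_simps)
qed auto

text \<open>Allows a periodic function to be evaluated through \<open>Arg\<close>, which picks one
  of the angles with a given \<open>cis\<close>.\<close>

lemma periodic_cis_cong:
  fixes f :: "real \<Rightarrow> 'a"
  assumes "\<And>x. f (x + 2 * pi) = f x" "cis x = cis y"
  shows "f x = f y"
proof -
  have "sin x = sin y \<and> cos x = cos y"
    using assms(2) by (auto simp: complex_eq_iff)
  then obtain n :: int where "x = y + 2 * pi * n"
    unfolding sin_cos_eq_iff by blast
  then show ?thesis using periodic_of_int[of f y n] assms(1) by auto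
qed

lemma cont_periodic_bounded:
  fixes f :: "real \<Rightarrow> 'a::real_normed_vector"
  assumes "cont_periodic f"
  obtains B where "B > 0" "\<And>x. norm (f x) \<le> B"
proof -
  have "compact (f ` {-pi..pi})"
    by (intro compact_continuous_image cont_periodic_continuous assms) auto
  then obtain B where B: "B > 0" "\<And>x. x \<in> {-pi..pi} \<Longrightarrow> norm (f x) \<le> B"
    using compact_imp_bounded bounded_pos by (metis imageI)
  have "norm (f x) \<le> B" for x
  proof -
    have "f x = f (Arg (cis x))"
      by (rule periodic_cis_cong) (use assms in \<open>auto simp: cont_periodic_eq cis_Arg\<close>)
    moreover have "Arg (cis x) \<in> {-pi..pi}"
      using Arg_bounded[of "cis x"] by auto
    ultimately show ?thesis using B(2) by simp
  qed
  with B(1) that show ?thesis by blast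
qed

lemma integral_periodic_derivative:
  fixes F :: "real \<Rightarrow> 'a::banach"
  assumes "\<And>x. (F has_vector_derivative f x) (at x)" "F (a + 2 * pi) = F a"
  shows "(f has_integral 0) {a..a + 2 * pi}"
  using fundamental_theorem_of_calculus[of a "a + 2 * pi" F f] assms
  by (auto intro: has_vector_derivative_at_within)

text \<open>With an antiderivative F, the shifted integral is \<open>F (t + 2 * pi) - F t\<close>,
  and its derivative in t vanishes by periodicity of f.\<close>

lemma integral_periodic_shift:
  fixes f :: "real \<Rightarrow> 'a::euclidean_space"
  assumes "cont_periodic f"
  shows "integral {0..2 * pi} (\<lambda>x. f (x + t)) = integral {0..2 * pi} f"
proof -
  have "isCont f x" for x
    using cont_periodic_continuous[OF assms, of UNIV] by (simp add: continuous_on_eq_continuous_at)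
  then obtain F where F: "\<And>x. (F has_vector_derivative f x) (at x)"
    using einterval_antiderivative[of "- \<infinity>" \<infinity> f] by auto
  have Ft: "((\<lambda>x. F (x + t)) has_vector_derivative f (x + t)) (at x)" for x t
  proof -
    have "((\<lambda>x. x + t) has_vector_derivative 1) (at x)"
      by (auto intro!: derivative_eq_intros)
    from vector_diff_chain_at[OF this F] show ?thesis by (simp add: o_def)
  qed
  have "((\<lambda>x. F (x + 2 * pi) - F x) has_derivative (\<lambda>h. 0)) (at x)" for x
    using has_vector_derivative_diff[OF Ft[of "2 * pi" x] F[of x]] cont_periodic_eq[OF assms, of x]
    by (simp add: has_vector_derivative_def)
  then have "F (t + 2 * pi) - F t = F (0 + 2 * pi) - F 0"
    using has_derivative_zero_constant[of UNIV "\<lambda>x. F (x + 2 * pi) - F x"] by (metis UNIV_I convex_UNIV)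
  moreover have "integral {0..2 * pi} (\<lambda>x. f (x + s)) = F (s + 2 * pi) - F s" for s
    using fundamental_theorem_of_calculus[of 0 "2 * pi" "\<lambda>x. F (x + s)" "\<lambda>x. f (x + s)"] Ft[of s]
    by (auto simp: add.commute intro!: integral_unique intro: has_vector_derivative_at_within)
  from this[of t] this[of 0] show ?thesis
    using calculation by simp
qed

section \<open>Fourier coefficients under shift and differentiation\<close>

lemma has_vector_derivative_cis_mult:
  "((\<lambda>x. cis (n * x + t)) has_vector_derivative (\<i> * of_real n) * cis (n * x + t)) (at x within S)"
  by (auto simp: has_vector_derivative_complex_iff intro!: derivative_eq_intros)

lemma integral_cis:
  assumes "n \<in> \<int>"
  shows "integral {0..2 * pi} (\<lambda>x. cis (n * x)) = (if n = 0 then of_real (2 * pi) else 0)"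
proof (cases "n = 0")
  case False
  have "((\<lambda>x. (1 / (\<i> * of_real n)) * cis (n * x + 0)) has_vector_derivative cis (n * x + 0)) (at x)" for x
    using has_vector_derivative_mult_right[OF has_vector_derivative_cis_mult[of n 0 x], of "1 / (\<i> * of_real n)"] False
    by simp
  from integral_periodic_derivative[OF this, of 0] False assms show ?thesis
    by (auto simp: integral_unique mult.commute[of n])
qed (simp add: scaleR_conv_of_real)

text \<open>Orders n \<ge> 0 suffice because f is real: order -n is the conjugate. Without the
  factor 1 / (2 pi), the harmonic of order n > 0 in f is
  \<open>Re (fourier_coeff f n * cis (n * x)) / pi\<close>.\<close>

definition fourier_coeff :: "(real \<Rightarrow> real) \<Rightarrow> nat \<Rightarrow> complex" where
  "fourier_coeff f n = integral {0..2 * pi} (\<lambda>x. f x *\<^sub>R cis (- real n * x))"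

lemma cont_periodic_fourier:
  "cont_periodic f \<Longrightarrow> cont_periodic (\<lambda>x. f x *\<^sub>R cis (- real n * x))"
  by (intro cont_periodic_scaleR cont_periodic_cis) auto

lemma fourier_coeff_add:
  "cont_periodic f \<Longrightarrow> cont_periodic g \<Longrightarrow>
    fourier_coeff (\<lambda>x. f x + g x) n = fourier_coeff f n + fourier_coeff g n"
  unfolding fourier_coeff_def scaleR_add_left
  by (intro integral_add cont_periodic_integrable cont_periodic_fourier)

lemma fourier_coeff_diff:
  "cont_periodic f \<Longrightarrow> cont_periodic g \<Longrightarrow>
    fourier_coeff (\<lambda>x. f x - g x) n = fourier_coeff f n - fourier_coeff g n"
  unfolding fourier_coeff_def scaleR_diff_left
  by (intro integral_diff cont_periodic_integrable cont_periodic_fourier)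

lemma fourier_coeff_cmult:
  "fourier_coeff (\<lambda>x. c * f x) n = of_real c * fourier_coeff f n"
  unfolding fourier_coeff_def scaleR_scaleR[symmetric] integral_cmul
  by (simp add: scaleR_conv_of_real)

lemma fourier_coeff_sum:
  assumes "finite A" "\<And>i. i \<in> A \<Longrightarrow> cont_periodic (f i)"
  shows "fourier_coeff (\<lambda>x. \<Sum>i\<in>A. f i x) n = (\<Sum>i\<in>A. fourier_coeff (f i) n)"
  using assms unfolding fourier_coeff_def scaleR_sum_left
  by (intro integral_sum cont_periodic_integrable cont_periodic_fourier) auto

lemma fourier_coeff_shift:
  assumes "cont_periodic f"
  shows "fourier_coeff (\<lambda>x. f (x + t)) n = cis (real n * t) * fourier_coeff f n"
proof -
  have "f (x + t) *\<^sub>R cis (- real n * x) =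
      cis (real n * t) * (f (x + t) *\<^sub>R cis (- real n * (x + t)))" for x
    by (simp add: scaleR_conv_of_real cis_mult algebra_simps)
  then have "fourier_coeff (\<lambda>x. f (x + t)) n =
      cis (real n * t) * integral {0..2 * pi} (\<lambda>x. f (x + t) *\<^sub>R cis (- real n * (x + t)))"
    unfolding fourier_coeff_def by (simp only: integral_mult_right)
  then show ?thesis
    using integral_periodic_shift[OF cont_periodic_fourier[OF assms, of n], of t]
    by (simp add: fourier_coeff_def)
qed

lemma norm_fourier_coeff_le:
  assumes "cont_periodic f" "\<And>x. \<bar>f x\<bar> \<le> B"
  shows "norm (fourier_coeff f n) \<le> B * (2 * pi)"
  unfolding fourier_coeff_def
  using integral_bound[of 0 "2 * pi" "\<lambda>x. f x *\<^sub>R cis (- real n * x)" B] assms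
    cont_periodic_continuous[OF cont_periodic_fourier[OF assms(1), of n], of "{0..2 * pi}"]
  by simp

text \<open>Integration by parts: the derivative of the periodic function f(x) cis(-n x) integrates
  to zero, so there is no boundary term.\<close>

lemma fourier_coeff_derivative:
  assumes f: "\<And>x. (f has_real_derivative f' x) (at x)" "\<And>x. f (x + 2 * pi) = f x"
    and f': "cont_periodic f'"
  shows "fourier_coeff f' n = \<i> * of_nat n * fourier_coeff f n"
proof -
  have f0: "cont_periodic f"
    by (intro cont_periodicI f(2) continuous_at_imp_continuous_on ballI DERIV_isCont[OF f(1)])
  define F where "F x = f x *\<^sub>R cis (- real n * x)" for x
  have "((\<lambda>x. f x *\<^sub>R cis (- real n * x + 0)) has_vector_derivative
      f x *\<^sub>R (\<i> * of_real (- real n) * cis (- real n * x + 0)) + f' x *\<^sub>R cis (- real n * x + 0)) (at x)" for x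
    by (rule has_vector_derivative_scaleR[OF f(1) has_vector_derivative_cis_mult])
  then have "(F has_vector_derivative
      f' x *\<^sub>R cis (- real n * x) - (\<i> * of_nat n) * (f x *\<^sub>R cis (- real n * x))) (at x)" for x
    by (simp add: F_def[abs_def] scaleR_conv_of_real algebra_simps)
  from integral_periodic_derivative[OF this, of 0]
  have "integral {0..2 * pi} (\<lambda>x. f' x *\<^sub>R cis (- real n * x) - (\<i> * of_nat n) * (f x *\<^sub>R cis (- real n * x))) = 0"
    using cont_periodic_eq[OF cont_periodic_fourier[OF f0, of n], of 0]
    by (intro integral_unique) (simp add: F_def)
  then show ?thesis
    unfolding fourier_coeff_def
    by (subst (asm) integral_diff)
       (simp_all only: integral_mult_right right_minus_eq cont_periodic_integrable
          cont_periodic_fourier[OF f'] cont_periodic_mult[OF cont_periodic_const cont_periodic_fourier[OF f0]])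
qed

lemma cont_periodic_harmonic: "cont_periodic (\<lambda>x. Re (a * cis (real m * x)))"
  by (intro cont_periodic_Re cont_periodic_mult cont_periodic_const cont_periodic_cis) auto

text \<open>Writing Re z as (z + cnj z) / 2 leaves the frequencies m - n and -m - n. For m > 0 the
  second is never 0, so only n = m survives, with half of 2 pi.\<close>

lemma fourier_coeff_harmonic:
  assumes "m > 0"
  shows "fourier_coeff (\<lambda>x. Re (a * cis (real m * x))) n = (if n = m then of_real pi * a else 0)"
proof -
  have "Re (a * cis (real m * x)) *\<^sub>R cis (- real n * x) =
      a / 2 * cis ((real m - real n) * x) + cnj a / 2 * cis ((- real m - real n) * x)" for x
  proof -
    have "complex_of_real (Re z) = (z + cnj z) / 2" for z
      by (simp add: complex_eq_iff)
    then show ?thesis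
      by (simp only: scaleR_conv_of_real)
         (simp add: cis_cnj add_divide_distrib ring_distribs mult.assoc cis_mult)
  qed
  then have "fourier_coeff (\<lambda>x. Re (a * cis (real m * x))) n =
      a / 2 * integral {0..2 * pi} (\<lambda>x. cis ((real m - real n) * x)) +
      cnj a / 2 * integral {0..2 * pi} (\<lambda>x. cis ((- real m - real n) * x))"
    unfolding fourier_coeff_def
    by (subst integral_mult_right[symmetric])+
       (simp add: integral_add cont_periodic_integrable cont_periodic_mult cont_periodic_const cont_periodic_cis)
  moreover have "real m - real n \<in> \<int>" "- real m - real n \<in> \<int>"
    by auto
  ultimately show ?thesis using assms by (auto simp: integral_cis simp del: times_complex.sel)
qed

section \<open>Uniqueness of Fourier coefficients\<close>

lemma bounded_linear_complex_real:
  fixes p :: "complex \<Rightarrow> real"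
  assumes "bounded_linear p"
  shows "p z = Re z * p 1 + Im z * p \<i>"
proof -
  interpret bounded_linear p by fact
  have "p z = p (Re z *\<^sub>R 1 + Im z *\<^sub>R \<i>)"
    by (rule arg_cong[of _ _ p]) (simp add: complex_eq_iff)
  then show ?thesis by (simp add: add scaleR)
qed

lemma real_polynomial_cis_cont_periodic:
  fixes p :: "complex \<Rightarrow> real"
  assumes "real_polynomial_function p"
  shows "cont_periodic (\<lambda>x. p (cis x))"
proof (rule cont_periodicI)
  have "continuous_on UNIV p"
    using assms continuous_on_polymonial_function real_polynomial_function_eq by blast
  then show "continuous_on UNIV (\<lambda>x. p (cis x))"
    by (rule continuous_on_compose2) (auto intro!: continuous_intros)
  show "p (cis (x + 2 * pi)) = p (cis x)" for x
    by (simp flip: cis_mult)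
qed

text \<open>A linear factor evaluated at \<open>cis x\<close> shifts frequencies by 1 up and down,
  so orthogonality to all exponentials survives multiplication by it. The induction needs arbitrary
  f because for a product the hypothesis on q is applied to f times p.\<close>

lemma fourier_orthogonal_polynomial:
  fixes p :: "complex \<Rightarrow> real"
  assumes "real_polynomial_function p" "cont_periodic f"
    "\<And>k. k \<in> \<int> \<Longrightarrow> integral {0..2 * pi} (\<lambda>x. f x *\<^sub>R cis (k * x)) = 0" "k \<in> \<int>"
  shows "integral {0..2 * pi} (\<lambda>x. (f x * p (cis x)) *\<^sub>R cis (k * x)) = 0"
  using assms
proof (induction arbitrary: f k rule: real_polynomial_function.induct)
  case (linear p)
  \<comment> \<open>Chosen so that \<open>p (cis x) = Re (w * cis x)\<close>.\<close>
  define w where "w = Complex (p 1) (- p \<i>)"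
  have *: "(f x * p (cis x)) *\<^sub>R cis (k * x) =
      w / 2 * (f x *\<^sub>R cis ((k + 1) * x)) + cnj w / 2 * (f x *\<^sub>R cis ((k - 1) * x))" for x
  proof -
    have "complex_of_real (p (cis x)) = (w * cis x + cnj w * cis (- x)) / 2"
      unfolding bounded_linear_complex_real[OF linear(1), of "cis x"]
      by (simp add: w_def complex_eq_iff algebra_simps)
    moreover have "cis ((k + 1) * x) = cis x * cis (k * x)" "cis ((k - 1) * x) = cis (- x) * cis (k * x)"
      by (simp_all add: cis_mult algebra_simps)
    ultimately show ?thesis
      by (simp only: scaleR_conv_of_real of_real_mult) (simp add: field_simps)
  qed
  have int: "(\<lambda>x. f x *\<^sub>R cis (j * x)) integrable_on {0..2 * pi}" if "j \<in> \<int>" for j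
    by (intro cont_periodic_integrable cont_periodic_scaleR cont_periodic_cis linear that)
  have "k + 1 \<in> \<int>" "k - 1 \<in> \<int>" using linear(4) by auto
  then show ?case
    unfolding *
    by (subst integral_add) (simp_all only: integral_mult_right linear(3) int integrable_on_mult_right, simp)
next
  case (const c)
  have "(f x * c) *\<^sub>R cis (k * x) = c *\<^sub>R (f x *\<^sub>R cis (k * x))" for x
    by simp
  then show ?case using const by (simp only: integral_cmul) simp
next
  case (add p q)
  have "(\<lambda>x. (f x * p (cis x)) *\<^sub>R cis (k * x)) integrable_on {0..2 * pi}"
    "(\<lambda>x. (f x * q (cis x)) *\<^sub>R cis (k * x)) integrable_on {0..2 * pi}"
    by (intro cont_periodic_integrable cont_periodic_scaleR cont_periodic_mult cont_periodic_cis
          real_polynomial_cis_cont_periodic add)+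
  then show ?case
    using add by (simp add: distrib_left scaleR_add_left integral_add)
next
  case (mult p q)
  have "integral {0..2 * pi} (\<lambda>x. (f x * p (cis x) * q (cis x)) *\<^sub>R cis (k * x)) = 0"
    by (intro mult cont_periodic_mult real_polynomial_cis_cont_periodic)
  then show ?case by (simp add: mult.assoc)
qed

text \<open>The function is f composed with \<open>Arg\<close>. On the cut of \<open>Arg\<close> it
  agrees, by periodicity, with \<open>f (Arg (- z) + pi)\<close>, whose cut lies on the opposite
  ray.\<close>

lemma cont_periodic_factor:
  assumes f: "cont_periodic (f :: real \<Rightarrow> 'a::real_normed_vector)"
  obtains F where "continuous_on (sphere 0 1) F" "\<And>x. F (cis x) = f x"
proof
  define F where "F z = f (Arg z)" for z
  have eq: "f a = f b" if "cis a = cis b" for a b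
    by (rule periodic_cis_cong) (use f that in \<open>auto simp: cont_periodic_eq\<close>)
  show "F (cis x) = f x" for x
    unfolding F_def by (rule eq) (simp add: cis_Arg)
  have F': "F z = f (Arg (- z) + pi)" if "z \<noteq> 0" for z
    unfolding F_def by (rule eq) (use that in \<open>simp add: cis_Arg flip: minus_cis\<close>)
  have fc: "isCont f x" for x
    using cont_periodic_continuous[OF f, of UNIV] by (simp add: continuous_on_eq_continuous_at)
  have "isCont F z" if "z \<in> sphere 0 1" for z
  proof (cases "z \<in> \<real>\<^sub>\<le>\<^sub>0")
    case False
    show ?thesis
      unfolding F_def[abs_def] by (rule continuous_at_compose[unfolded o_def, OF continuous_at_Arg[OF False] fc])
  next
    case True
    with that have "- z \<notin> \<real>\<^sub>\<le>\<^sub>0"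
      by (auto simp: complex_nonpos_Reals_iff complex_nonneg_Reals_iff cmod_def)
    then have "isCont (\<lambda>z. Arg (- z) + pi) z"
      by (intro continuous_intros isCont_o2[OF _ continuous_at_Arg]) auto
    then have "isCont (\<lambda>z. f (Arg (- z) + pi)) z"
      by (rule isCont_o2[OF _ fc])
    moreover have "z \<noteq> 0" using that by auto
    then have "eventually (\<lambda>w. F w = f (Arg (- w) + pi)) (nhds z)"
      using F' by (auto elim!: eventually_mono[OF t1_space_nhds])
    ultimately show ?thesis
      using isCont_cong[of F "\<lambda>w. f (Arg (- w) + pi)" z] by simp
  qed
  then show "continuous_on (sphere 0 1) F"
    by (intro continuous_at_imp_continuous_on) auto
qed

text \<open>For a polynomial p close to f on the circle, f is orthogonal to p, hence the integral of
  f^2 equals that of f (f - p), which is arbitrarily small.\<close>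

lemma fourier_unique:
  assumes f: "cont_periodic f" and zero: "\<And>n. fourier_coeff f n = 0"
  shows "f x = 0"
proof -
  have z: "integral {0..2 * pi} (\<lambda>x. f x *\<^sub>R cis (k * x)) = 0" if k: "k \<in> \<int>" for k
  proof -
    from k obtain i :: int where i: "k = i" by (auto elim: Ints_cases)
    show ?thesis
    proof (cases "i \<le> 0")
      case True
      then show ?thesis
        using zero[of "nat (- i)"] unfolding fourier_coeff_def i by simp
    next
      case False
      \<comment> \<open>\<open>fourier_coeff\<close> covers the frequencies k \<le> 0; the positive
        ones follow by conjugation, f being real.\<close>
      have "(\<lambda>x. f x *\<^sub>R cis (- k * x)) integrable_on {0..2 * pi}"
        by (intro cont_periodic_integrable cont_periodic_scaleR cont_periodic_cis f) (use k in auto)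
      then have "((\<lambda>x. f x *\<^sub>R cis (- k * x)) has_integral 0) {0..2 * pi}"
        using zero[of "nat i"] False unfolding fourier_coeff_def i by (simp add: has_integral_iff)
      from has_integral_linear[OF this bounded_linear_cnj] show ?thesis
        by (intro integral_unique) (simp add: o_def cis_cnj)
    qed
  qed
  obtain B where B: "B > 0" "\<And>x. norm (f x) \<le> B"
    using cont_periodic_bounded[OF f] by blast
  obtain F where F: "continuous_on (sphere 0 1) F" "\<And>x. F (cis x) = f x"
    using cont_periodic_factor[OF f] by blast
  define I where "I = integral {0..2 * pi} (\<lambda>x. f x * f x)"
  have "I \<le> e" if e: "e > 0" for e
  proof -
    \<comment> \<open>Makes the final bound \<open>B * d * (2 * pi)\<close> equal to e.\<close>
    define d where "d = e / (B * (2 * pi))"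
    have d: "d > 0" using e B(1) by (simp add: d_def)
    obtain p where p: "real_polynomial_function p" "\<And>z. z \<in> sphere 0 1 \<Longrightarrow> \<bar>F z - p z\<bar> < d"
      using Stone_Weierstrass_real_polynomial_function[OF _ F(1) d] by auto
    have pc: "cont_periodic (\<lambda>x. p (cis x))"
      by (rule real_polynomial_cis_cont_periodic[OF p(1)])
    have "integral {0..2 * pi} (\<lambda>x. (f x * p (cis x)) *\<^sub>R cis (0 * x)) = 0"
      by (rule fourier_orthogonal_polynomial[OF p(1) f z]) auto
    moreover have "(\<lambda>x. f x * p (cis x)) integrable_on {0..2 * pi}"
      by (intro cont_periodic_integrable cont_periodic_mult f pc)
    from integral_linear[OF this bounded_linear_of_real[where 'a = complex]]
    have "integral {0..2 * pi} (\<lambda>x. complex_of_real (f x * p (cis x))) =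
        of_real (integral {0..2 * pi} (\<lambda>x. f x * p (cis x)))"
      by (simp add: o_def)
    ultimately have "integral {0..2 * pi} (\<lambda>x. f x * p (cis x)) = 0"
      by (simp add: scaleR_conv_of_real)
    then have "I = integral {0..2 * pi} (\<lambda>x. f x * (f x - p (cis x)))"
      unfolding I_def right_diff_distrib
      by (subst integral_diff) (auto intro!: cont_periodic_integrable cont_periodic_mult f pc)
    also have "norm \<dots> \<le> B * d * (2 * pi - 0)"
    proof (rule integral_bound)
      show "continuous_on {0..2 * pi} (\<lambda>x. f x * (f x - p (cis x)))"
        by (intro cont_periodic_continuous cont_periodic_mult cont_periodic_diff f pc)
      show "norm (f x * (f x - p (cis x))) \<le> B * d" for x
        using B(2)[of x] p(2)[of "cis x"] B(1) d F(2)[of x]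
        by (auto simp: abs_mult intro!: mult_mono)
    qed auto
    also have "\<dots> = e" using B(1) by (simp add: d_def)
    finally show ?thesis by simp
  qed
  then have "I \<le> 0" by (meson dense not_less)
  moreover have "I \<ge> 0"
    unfolding I_def
    by (intro integral_nonneg cont_periodic_integrable cont_periodic_mult f) auto
  \<comment> \<open>Translating by x turns the arbitrary point x into the endpoint 0 of the
    interval, so no reduction modulo 2 pi is needed.\<close>
  ultimately have "integral {0..2 * pi} (\<lambda>y. f (y + x) * f (y + x)) = 0"
    using integral_periodic_shift[OF cont_periodic_mult[OF f f], of x] by (simp add: I_def)
  moreover have "cont_periodic (\<lambda>y. f (y + x) * f (y + x))"
    by (intro cont_periodic_mult cont_periodic_shift f)
  ultimately have "\<forall>y\<in>{0..2 * pi}. f (y + x) * f (y + x) = 0"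
    by (subst integral_eq_0_iff[symmetric]) (auto intro: cont_periodic_continuous)
  from bspec[OF this, of 0] show ?thesis by simp
qed

section \<open>Uniform limits and Fourier series\<close>

lemma uniform_limit_cont_periodic:
  fixes f :: "nat \<Rightarrow> real \<Rightarrow> 'a::real_normed_vector"
  assumes "uniform_limit UNIV f g sequentially" "\<And>k. cont_periodic (f k)"
  shows "cont_periodic g"
proof (rule cont_periodicI)
  show "continuous_on UNIV g"
    by (rule uniform_limit_theorem[OF _ assms(1)]) (simp_all add: assms cont_periodic_continuous)
  have lim: "(\<lambda>k. f k x) \<longlonglongrightarrow> g x" for x
    using tendsto_uniform_limitI[OF assms(1)] by simp
  show "g (x + 2 * pi) = g x" for x
    using LIMSEQ_unique[OF lim[of x]] lim[of "x + 2 * pi"] cont_periodic_eq[OF assms(2)] by simp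
qed

lemma uniform_limit_fourier_coeff:
  assumes "uniform_limit UNIV f g sequentially" "\<And>k. cont_periodic (f k)"
  shows "(\<lambda>k. fourier_coeff (f k) n) \<longlonglongrightarrow> fourier_coeff g n"
proof (rule tendstoI)
  fix e :: real assume "e > 0"
  \<comment> \<open>Integration over a period costs a factor 2 pi < 8, hence the 10.\<close>
  then have "\<forall>\<^sub>F k in sequentially. \<forall>x\<in>UNIV. dist (f k x) (g x) < e / 10"
    using uniform_limitD[OF assms(1), of "e / 10"] by simp
  then show "\<forall>\<^sub>F k in sequentially. dist (fourier_coeff (f k) n) (fourier_coeff g n) < e"
  proof eventually_elim
    case (elim k)
    have g: "cont_periodic g" by (rule uniform_limit_cont_periodic[OF assms])
    have "norm (fourier_coeff (\<lambda>x. f k x - g x) n) \<le> e / 10 * (2 * pi)"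
      using elim by (intro norm_fourier_coeff_le cont_periodic_diff assms g)
        (auto simp: dist_real_def less_imp_le)
    also have "\<dots> < e" using pi_less_4 \<open>e > 0\<close> by simp
    finally show ?case
      using fourier_coeff_diff[OF assms(2)[of k] g, of n] by (simp add: dist_norm)
  qed
qed

text \<open>The series converges uniformly, so its coefficients may be computed termwise; they are
  those of f, and uniqueness applies. The mean is assumed zero because a constant term would carry 1
  / (2 pi) instead of 1 / pi.\<close>

lemma fourier_series:
  assumes f: "cont_periodic f" and f0: "fourier_coeff f 0 = 0"
    and sum: "summable (\<lambda>n. norm (fourier_coeff f n))"
  shows "f x = (\<Sum>n. Re (fourier_coeff f n * cis (real n * x)) / pi)"
proof -
  define h where "h n x = Re (fourier_coeff f n / of_real pi * cis (real n * x))" for n x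
  define g where "g x = (\<Sum>n. h n x)" for x
  have h: "cont_periodic (h n)" for n
    unfolding h_def[abs_def] by (rule cont_periodic_harmonic)
  have sumh: "cont_periodic (\<lambda>x. \<Sum>n<N. h n x)" for N
    by (induction N) (auto intro: cont_periodic_const cont_periodic_add h)
  have lim: "uniform_limit UNIV (\<lambda>N x. \<Sum>n<N. h n x) g sequentially"
    unfolding g_def[abs_def]
  proof (rule Weierstrass_m_test)
    show "summable (\<lambda>n. norm (fourier_coeff f n) / pi)"
      by (rule summable_divide[OF sum])
    show "norm (h n x) \<le> norm (fourier_coeff f n) / pi" for n x
      using abs_Re_le_cmod[of "fourier_coeff f n / of_real pi * cis (real n * x)"]
      by (simp add: h_def norm_mult norm_divide)
  qed
  have g: "cont_periodic g" by (rule uniform_limit_cont_periodic[OF lim sumh])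
  have "fourier_coeff (h k) n = (if n = k then fourier_coeff f n else 0)" for k n
  proof (cases "k = 0")
    case True
    have "h k = (\<lambda>x. 0)" by (simp add: h_def[abs_def] True f0)
    then show ?thesis using f0 True by (simp add: fourier_coeff_def)
  next
    case False
    then show ?thesis
      using fourier_coeff_harmonic[of k "fourier_coeff f k / of_real pi" n]
      unfolding h_def[abs_def] by (auto simp del: times_complex.sel)
  qed
  then have "fourier_coeff (\<lambda>x. \<Sum>k<N. h k x) n = (if n < N then fourier_coeff f n else 0)" for N n
    by (subst fourier_coeff_sum) (auto intro: h)
  then have "(\<lambda>N. if n < N then fourier_coeff f n else 0) \<longlonglongrightarrow> fourier_coeff g n" for n
    using uniform_limit_fourier_coeff[OF lim sumh, of n] by simp
  moreover have "(\<lambda>N. if n < N then fourier_coeff f n else 0) \<longlonglongrightarrow> fourier_coeff f n" for n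
    by (rule tendsto_eventually, rule eventually_mono[OF eventually_gt_at_top[of n]]) simp
  ultimately have "fourier_coeff g n = fourier_coeff f n" for n
    by (rule LIMSEQ_unique)
  then have "f x - g x = 0"
    by (intro fourier_unique cont_periodic_diff f g) (simp add: fourier_coeff_diff f g)
  then show ?thesis by (simp add: g_def h_def)
qed

text \<open>Expressing the derivative as a phase advance by pi / 2 matches the argument shift in the
  recursion for evolvents.\<close>

lemma harmonic_has_derivative:
  "((\<lambda>x. Re (a * cis (real m * x + t))) has_real_derivative
     real m * Re (a * cis (real m * x + (t + pi / 2)))) (at x)"
  by (auto simp: sin_add cos_add algebra_simps intro!: derivative_eq_intros)

lemma deriv_harmonic:
  "(deriv ^^ j) (\<lambda>x. Re (a * cis (real m * x))) =
     (\<lambda>x. real m ^ j * Re (a * cis (real m * x + real j * (pi / 2))))"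
proof (induction j)
  case (Suc j)
  have "deriv (\<lambda>x. real m ^ j * Re (a * cis (real m * x + real j * (pi / 2)))) x =
      real m ^ Suc j * Re (a * cis (real m * x + real (Suc j) * (pi / 2)))" for x
  proof -
    have "real (Suc j) * (pi / 2) = real j * (pi / 2) + pi / 2"
      by (simp add: field_simps)
    then show ?thesis
      using DERIV_imp_deriv[OF DERIV_cmult[OF harmonic_has_derivative[of a m "real j * (pi / 2)" x], of "real m ^ j"]]
      by (simp only: power_Suc2 mult.assoc)
  qed
  then show ?case unfolding funpow.simps o_apply Suc.IH by blast
qed simp

subsection \<open>Sequences of iterated evolvents\<close>

text \<open>Isolates the analytic content: the asymptotics depend only on this recursion, not on the
  geometry of the curves.\<close>

locale evolvent_seq =
  fixes f :: "nat \<Rightarrow> real \<Rightarrow> real"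
  assumes cont_periodic: "cont_periodic (f k)"
    and has_derivative: "(f (Suc k) has_real_derivative f k (x + pi / 2)) (at x)"
begin

lemma fourier_coeff_Suc:
  "\<i> * of_nat n * fourier_coeff (f (Suc k)) n = cis (real n * (pi / 2)) * fourier_coeff (f k) n"
  using fourier_coeff_derivative[OF has_derivative cont_periodic_eq[OF cont_periodic]
      cont_periodic_shift[OF cont_periodic], of k n]
  by (simp add: fourier_coeff_shift cont_periodic)

text \<open>Each \<open>f k\<close>, including \<open>f 0\<close>, is a shifted derivative of a
  periodic function, so its mean is zero.\<close>

lemma fourier_coeff_0: "fourier_coeff (f k) 0 = 0"
  using fourier_coeff_Suc[of 0 k] by simp

lemma fourier_coeff_power:
  assumes "n > 0"
  shows "fourier_coeff (f k) n = (cis ((real n - 1) * (pi / 2)) / of_nat n) ^ k * fourier_coeff (f 0) n"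
proof (induction k)
  case (Suc k)
  \<comment> \<open>The shift contributes n quarter turns and the derivative takes one back; order 1
    is therefore left fixed.\<close>
  have "cis (real n * (pi / 2)) = \<i> * cis ((real n - 1) * (pi / 2))"
  proof -
    have "real n * (pi / 2) = pi / 2 + (real n - 1) * (pi / 2)"
      by (simp add: field_simps)
    then show ?thesis by (simp only: cis_pi_half flip: cis_mult)
  qed
  then have "fourier_coeff (f (Suc k)) n = cis ((real n - 1) * (pi / 2)) / of_nat n * fourier_coeff (f k) n"
    using fourier_coeff_Suc[of n k] assms by (simp add: field_simps)
  then show ?case using Suc by simp
qed simp

lemma norm_fourier_coeff:
  assumes "k > 0"
  shows "norm (fourier_coeff (f k) n) = norm (fourier_coeff (f 0) n) / real n ^ k"
proof (cases "n = 0")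
  case False
  then show ?thesis
    by (subst fourier_coeff_power) (simp_all add: norm_mult norm_power norm_divide power_divide)
qed (simp add: fourier_coeff_0)

text \<open>The order \<open>m\<close> harmonic of \<^term>\<open>f k\<close> is, up to the factor \<open>1 / m\<^sup>k\<close>, that of \<^term>\<open>f 0\<close> rotated by \<^term>\<open>phase m k\<close>.\<close>

definition phase :: "nat \<Rightarrow> nat \<Rightarrow> real" where
  "phase m k = - ((real m - 1) * real k * (pi / (2 * real m)))"

text \<open>In the tail n > m, two of the k factors m / n are kept to make the sum converge; each of
  the remaining k - 2 is at most m / (m + 1). This gives a constant independent of k and explains k
  \<ge> 2.\<close>

lemma leading_harmonic_bound:
  assumes m: "m > 0" and zero: "\<And>n. n < m \<Longrightarrow> fourier_coeff (f 0) n = 0"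
  obtains C where "C > 0"
    "\<And>k x. k \<ge> 2 \<Longrightarrow> \<bar>real m ^ k * f k (x + phase m k)
        - Re (fourier_coeff (f 0) m / of_real pi * cis (real m * x))\<bar>
      \<le> C * (real m / real (Suc m)) ^ k"
proof -
  define c where "c n = fourier_coeff (f 0) n" for n
  define q where "q = real m / real (Suc m)"
  have q: "q > 0" using m by (simp add: q_def)
  obtain B where B: "B > 0" "\<And>x. norm (f 0 x) \<le> B"
    using cont_periodic_bounded[OF cont_periodic[of 0]] by blast
  define M where "M = B * (2 * pi)"
  have M: "M > 0" "\<And>n. norm (c n) \<le> M"
    using norm_fourier_coeff_le[OF cont_periodic[of 0], of B] B by (auto simp: M_def c_def)
  have sq: "summable (\<lambda>n. inverse (real n ^ k))" if "k \<ge> 2" for k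
    using inverse_power_summable[of k, where 'a = real] that by simp
  have sq': "summable (\<lambda>n. inverse (real (n + Suc m) ^ 2))"
    using summable_ignore_initial_segment[OF sq[of 2], of "Suc m"] by simp
  define S where "S = (\<Sum>n. inverse (real (n + Suc m) ^ 2))"
  have S: "S > 0"
    unfolding S_def by (rule suminf_pos[OF sq']) simp
  \<comment> \<open>The reserved factors sum to \<open>real m ^ 2 * S\<close>; division by
    \<open>q ^ 2\<close> turns \<open>q ^ (k - 2)\<close> into \<open>q ^ k\<close>.\<close>
  define C where "C = M / pi * real m ^ 2 * S / q ^ 2"
  show thesis
  proof (rule that[of C])
    show "C > 0" using M S m q by (simp add: C_def)
    fix k :: nat and x assume k: "k \<ge> 2"
    define t where "t n = Re (fourier_coeff (f k) n * cis (real n * (x + phase m k))) / pi" for n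
    have cn: "norm (fourier_coeff (f k) n) \<le> M * inverse (real n ^ k)" for n
      using norm_fourier_coeff[of k n] M(2)[of n] k by (simp add: c_def divide_inverse mult_right_mono)
    have sumc: "summable (\<lambda>n. norm (fourier_coeff (f k) n))"
      by (rule summable_comparison_test'[OF summable_mult[OF sq[OF k], of M]]) (use cn in simp)
    have tb: "\<bar>t n\<bar> \<le> M / pi * inverse (real n ^ k)" for n
      using abs_Re_le_cmod[of "fourier_coeff (f k) n * cis (real n * (x + phase m k))"] cn[of n]
      by (simp add: t_def norm_mult divide_right_mono)
    have sumt: "summable t"
      by (rule summable_comparison_test'[OF summable_mult[OF sq[OF k], of "M / pi"]]) (use tb in simp)
    have "f k (x + phase m k) = (\<Sum>n. t n)"
      unfolding t_def by (rule fourier_series[OF cont_periodic fourier_coeff_0 sumc])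
    also have "\<dots> = (\<Sum>n. t (n + Suc m)) + (\<Sum>n<Suc m. t n)"
      by (rule suminf_split_initial_segment[OF sumt])
    also have "(\<Sum>n<Suc m. t n) = t m"
    proof -
      have "t n = 0" if "n < m" for n
      proof -
        have "fourier_coeff (f k) n = 0"
          using norm_fourier_coeff[of k n] zero[OF that] k by simp
        then show ?thesis by (simp add: t_def)
      qed
      then show ?thesis by simp
    qed
    finally have fk: "real m ^ k * f k (x + phase m k) = real m ^ k * (\<Sum>n. t (n + Suc m)) + real m ^ k * t m"
      by (simp add: algebra_simps)
    have "real m ^ k * t m = Re (c m / of_real pi * cis (real m * x))"
    proof -
      \<comment> \<open>\<open>phase m k\<close> is the solution t of k (m - 1) pi / 2 + m t = 0, so
        it cancels the rotation accumulated in k steps.\<close>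
      have "(cis ((real m - 1) * (pi / 2)) ^ k) * cis (real m * (x + phase m k)) = cis (real m * x)"
      proof -
        have "real k * ((real m - 1) * (pi / 2)) + real m * (x + phase m k) = real m * x"
          using m by (simp add: phase_def field_simps)
        then show ?thesis unfolding Complex.DeMoivre cis_mult by (rule arg_cong)
      qed
      then have "of_real (real m ^ k) * (fourier_coeff (f k) m * cis (real m * (x + phase m k))) =
          c m * cis (real m * x)"
        using m by (simp add: fourier_coeff_power[of m k] c_def power_divide field_simps)
      then have "Re (of_real (real m ^ k) * (fourier_coeff (f k) m * cis (real m * (x + phase m k)))) =
          Re (c m * cis (real m * x))"
        by (rule arg_cong)
      moreover have "Re (of_real r * z) = r * Re z" for r z
        by simp
      ultimately show ?thesis
        by (simp only: t_def Re_divide_of_real times_divide_eq_left times_divide_eq_right)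
    qed
    moreover have "\<bar>real m ^ k * (\<Sum>n. t (n + Suc m))\<bar> \<le> C * q ^ k"
    proof -
      have pk: "y ^ k = y ^ (k - 2) * y ^ 2" for y :: real
        using k by (metis le_add_diff_inverse2 power_add)
      have le: "\<bar>real m ^ k * t (n + Suc m)\<bar> \<le> M / pi * q ^ (k - 2) * real m ^ 2 * inverse (real (n + Suc m) ^ 2)" for n
      proof -
        let ?N = "real (n + Suc m)"
        have "\<bar>real m ^ k * t (n + Suc m)\<bar> \<le> real m ^ k * (M / pi * inverse (?N ^ k))"
          unfolding abs_mult using tb[of "n + Suc m"] by (intro mult_mono) auto
        also have "\<dots> = M / pi * (real m / ?N) ^ (k - 2) * (real m ^ 2 * inverse (?N ^ 2))"
          unfolding pk[of "real m"] pk[of ?N] power_divide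
          by (simp only: divide_inverse inverse_mult_distrib mult_ac)
        also have "\<dots> \<le> M / pi * q ^ (k - 2) * (real m ^ 2 * inverse (?N ^ 2))"
          unfolding q_def using M(1)
          by (intro mult_right_mono mult_left_mono power_mono divide_left_mono) auto
        finally show ?thesis by (simp add: mult.assoc)
      qed
      have st: "summable (\<lambda>n. real m ^ k * t (n + Suc m))"
        by (intro summable_mult summable_ignore_initial_segment sumt)
      have "\<bar>real m ^ k * (\<Sum>n. t (n + Suc m))\<bar> = norm (\<Sum>n. real m ^ k * t (n + Suc m))"
        using summable_ignore_initial_segment[OF sumt, of "Suc m"] by (simp add: suminf_mult)
      also have "\<dots> \<le> (\<Sum>n. M / pi * q ^ (k - 2) * real m ^ 2 * inverse (real (n + Suc m) ^ 2))"
        by (rule norm_suminf_le[OF _ summable_mult[OF sq']]) (use le in simp)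
      also have "\<dots> = M / pi * q ^ (k - 2) * real m ^ 2 * S"
        unfolding S_def by (rule suminf_mult[OF sq'])
      also have "\<dots> = C * q ^ k"
        using q by (simp add: C_def pk[of q])
      finally show ?thesis .
    qed
    ultimately show "\<bar>real m ^ k * f k (x + phase m k)
        - Re (fourier_coeff (f 0) m / of_real pi * cis (real m * x))\<bar>
      \<le> C * (real m / real (Suc m)) ^ k"
      unfolding fk q_def[symmetric] c_def by simp
  qed
qed

text \<open>Each differentiation undoes one evolvent step; the descent stops at \<open>f 0\<close>,
  which is only known to be continuous.\<close>

lemma deriv_shifted:
  "j \<le> k \<Longrightarrow> (deriv ^^ j) (\<lambda>x. a * f k (x + t)) = (\<lambda>x. a * f (k - j) (x + t + real j * (pi / 2)))"
proof (induction j)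
  case (Suc j)
  have "((\<lambda>x. a * f (k - j) (x + t + real j * (pi / 2))) has_real_derivative
      a * f (k - Suc j) (x + t + real (Suc j) * (pi / 2))) (at x)" for x
  proof -
    have "Suc (k - Suc j) = k - j" using Suc.prems by simp
    then have "(f (k - j) has_real_derivative f (k - Suc j) (x + (t + real j * (pi / 2)) + pi / 2))
        (at (x + (t + real j * (pi / 2))))"
      using has_derivative[of "k - Suc j"] by metis
    then have "((\<lambda>x. f (k - j) (x + (t + real j * (pi / 2)))) has_real_derivative
        f (k - Suc j) (x + (t + real j * (pi / 2)) + pi / 2)) (at x)"
      unfolding DERIV_shift .
    moreover have "x + (t + real j * (pi / 2)) + pi / 2 = x + t + real (Suc j) * (pi / 2)"
      by (simp add: field_simps)
    ultimately show ?thesis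
      using DERIV_cmult[of _ _ x UNIV a] by (simp only: add.assoc)
  qed
  then have "deriv (\<lambda>x. a * f (k - j) (x + t + real j * (pi / 2))) x =
      a * f (k - Suc j) (x + t + real (Suc j) * (pi / 2))" for x
    by (rule DERIV_imp_deriv)
  then show ?case using Suc by auto
qed simp

lemma rescaled_limit:
  assumes m: "m > 0" and zero: "\<And>n. n < m \<Longrightarrow> fourier_coeff (f 0) n = 0"
  shows "uniform_limit UNIV (\<lambda>k. (deriv ^^ j) (\<lambda>x. real m ^ k * f k (x + phase m k)))
     ((deriv ^^ j) (\<lambda>x. Re (fourier_coeff (f 0) m / of_real pi * cis (real m * x)))) sequentially"
proof (rule uniform_limitI)
  fix e :: real assume e: "e > 0"
  define a where "a = fourier_coeff (f 0) m / of_real pi"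
  define q where "q = real m / real (Suc m)"
  have q: "q > 0" "q < 1" using m by (simp_all add: q_def)
  obtain C where C: "C > 0"
    "\<And>k x. k \<ge> 2 \<Longrightarrow> \<bar>real m ^ k * f k (x + phase m k) - Re (a * cis (real m * x))\<bar> \<le> C * q ^ k"
    using leading_harmonic_bound[OF m zero] unfolding a_def q_def by blast
  have "(\<lambda>k. real m ^ j * C / q ^ j * q ^ k) \<longlonglongrightarrow> real m ^ j * C / q ^ j * 0"
    using q by (intro tendsto_intros LIMSEQ_power_zero) auto
  then have "\<forall>\<^sub>F k in sequentially. real m ^ j * C / q ^ j * q ^ k < e"
    using e by (intro order_tendstoD(2)) auto
  then show "\<forall>\<^sub>F k in sequentially. \<forall>x\<in>UNIV.
      dist ((deriv ^^ j) (\<lambda>x. real m ^ k * f k (x + phase m k)) x)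
       ((deriv ^^ j) (\<lambda>x. Re (fourier_coeff (f 0) m / of_real pi * cis (real m * x))) x) < e"
    using eventually_ge_at_top[of "j + 2"]
  proof eventually_elim
    case (elim k)
    have "\<bar>(deriv ^^ j) (\<lambda>x. real m ^ k * f k (x + phase m k)) x
        - (deriv ^^ j) (\<lambda>x. Re (a * cis (real m * x))) x\<bar> \<le> real m ^ j * C / q ^ j * q ^ k" for x
    proof -
      \<comment> \<open>On the harmonic, j derivatives move the argument by j pi / (2 m); on
        \<open>f k\<close> they move it by j pi / 2. The difference is exactly
        \<open>phase m (k - j) - phase m k\<close>, so y turns the claim into the undifferentiated
        bound at index k - j.\<close>
      define y where "y = x + real j * (pi / (2 * real m))"
      have 1: "x + phase m k + real j * (pi / 2) = y + phase m (k - j)"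
        using m elim by (simp add: phase_def y_def of_nat_diff field_simps)
      have 2: "real m * x + real j * (pi / 2) = real m * y"
        using m by (simp add: y_def field_simps)
      have 3: "b ^ k = b ^ j * b ^ (k - j)" for b :: real
        using elim by (simp flip: power_add)
      have "j \<le> k" using elim by simp
      have "(deriv ^^ j) (\<lambda>x. real m ^ k * f k (x + phase m k)) x
          - (deriv ^^ j) (\<lambda>x. Re (a * cis (real m * x))) x =
          real m ^ j * (real m ^ (k - j) * f (k - j) (y + phase m (k - j)) - Re (a * cis (real m * y)))"
        unfolding deriv_shifted[OF \<open>j \<le> k\<close>] deriv_harmonic
        unfolding 1 2 3[of "real m"] right_diff_distrib mult.assoc ..
      then have "\<bar>(deriv ^^ j) (\<lambda>x. real m ^ k * f k (x + phase m k)) x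
          - (deriv ^^ j) (\<lambda>x. Re (a * cis (real m * x))) x\<bar> =
          real m ^ j * \<bar>real m ^ (k - j) * f (k - j) (y + phase m (k - j)) - Re (a * cis (real m * y))\<bar>"
        by (simp only: abs_mult) simp
      \<comment> \<open>The choice k \<ge> j + 2 ensures the index k - j \<ge> 2 that the bound
        requires.\<close>
      also have "\<dots> \<le> real m ^ j * (C * q ^ (k - j))"
        using elim by (intro mult_left_mono C) auto
      also have "\<dots> = real m ^ j * C / q ^ j * q ^ k"
        using q by (simp add: 3[of q])
      finally show ?thesis .
    qed
    then show ?case
      using elim(1) unfolding a_def dist_real_def by (blast intro: le_less_trans)
  qed
qed

text \<open>Shifting multiplies a coefficient by a unit complex number, so norms forget the unknown
  rotations \<theta>.\<close>

lemma uniform_limit_fourier_coeff_norm: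
  assumes "uniform_limit UNIV (\<lambda>k x. a k * f k (x + \<theta> k)) g sequentially"
  shows "(\<lambda>k. \<bar>a k\<bar> * norm (fourier_coeff (f 0) n) / real n ^ k) \<longlonglongrightarrow> norm (fourier_coeff g n)"
proof -
  have "cont_periodic (\<lambda>x. a k * f k (x + \<theta> k))" for k
    by (intro cont_periodic_mult cont_periodic_const cont_periodic_shift cont_periodic)
  from tendsto_norm[OF uniform_limit_fourier_coeff[OF assms this, of n]]
  have "(\<lambda>k. norm (fourier_coeff (\<lambda>x. a k * f k (x + \<theta> k)) n)) \<longlonglongrightarrow> norm (fourier_coeff g n)" .
  moreover have "\<forall>\<^sub>F k in sequentially. norm (fourier_coeff (\<lambda>x. a k * f k (x + \<theta> k)) n) =
      \<bar>a k\<bar> * norm (fourier_coeff (f 0) n) / real n ^ k"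
    using eventually_gt_at_top[of 0]
    by eventually_elim
      (simp add: fourier_coeff_cmult fourier_coeff_shift cont_periodic norm_mult norm_fourier_coeff)
  ultimately show ?thesis by (rule Lim_transform_eventually)
qed

text \<open>No growth rate of the factors a is assumed: convergence of the order m coefficients
  already controls |a k| / m^k, and every order n > m is smaller by a further factor of order (m /
  n)^k.\<close>

lemma uniform_limit_harmonic:
  assumes lim: "uniform_limit UNIV (\<lambda>k x. a k * f k (x + \<theta> k)) g sequentially"
    and m: "m > 0" and zero: "\<And>n. n < m \<Longrightarrow> fourier_coeff (f 0) n = 0"
    and nz: "fourier_coeff (f 0) m \<noteq> 0"
  shows "g x = Re (fourier_coeff g m / of_real pi * cis (real m * x))"
proof -
  have g: "cont_periodic g"
    by (rule uniform_limit_cont_periodic[OF lim])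
       (intro cont_periodic_mult cont_periodic_const cont_periodic_shift cont_periodic)
  have "fourier_coeff g n = 0" if "n \<noteq> m" for n
  proof (cases "n < m")
    case True
    then have "(\<lambda>k. 0) \<longlonglongrightarrow> norm (fourier_coeff g n)"
      using uniform_limit_fourier_coeff_norm[OF lim, of n] zero by simp
    then show ?thesis
      using LIMSEQ_unique[OF tendsto_const] by fastforce
  next
    case False
    with that have n: "n > m" by simp
    \<comment> \<open>Rewrites the order n sequence as the convergent order m sequence times
      \<open>A * (m / n) ^ k\<close>.\<close>
    define A where "A = norm (fourier_coeff (f 0) n) / norm (fourier_coeff (f 0) m)"
    have "(\<lambda>k. \<bar>a k\<bar> * norm (fourier_coeff (f 0) m) / real m ^ k * A * (real m / real n) ^ k)
        \<longlonglongrightarrow> norm (fourier_coeff g m) * A * 0"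
      using n by (intro tendsto_intros uniform_limit_fourier_coeff_norm[OF lim] LIMSEQ_power_zero) auto
    moreover have "\<bar>a k\<bar> * norm (fourier_coeff (f 0) m) / real m ^ k * A * (real m / real n) ^ k =
        \<bar>a k\<bar> * norm (fourier_coeff (f 0) n) / real n ^ k" for k
      using m nz by (simp add: A_def power_divide)
    ultimately have "(\<lambda>k. \<bar>a k\<bar> * norm (fourier_coeff (f 0) n) / real n ^ k) \<longlonglongrightarrow> 0"
      by (simp only: mult_zero_right)
    from LIMSEQ_unique[OF uniform_limit_fourier_coeff_norm[OF lim, of n] this] show ?thesis
      by simp
  qed
  then have "fourier_coeff (\<lambda>x. g x - Re (fourier_coeff g m / of_real pi * cis (real m * x))) n = 0" for n
    unfolding fourier_coeff_diff[OF g cont_periodic_harmonic] fourier_coeff_harmonic[OF m] by simp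
  from fourier_unique[OF cont_periodic_diff[OF g cont_periodic_harmonic] this, of x] show ?thesis
    by (simp only: right_minus_eq)
qed

end

subsection \<open>Support functions of hedgehogs\<close>

lemma inner_cis_Re: "z \<bullet> cis x = Re (cnj z * cis x)"
  by (simp add: inner_complex_def)

text \<open>A change of origin affects only the harmonic of order 1; \<open>real 1\<close> keeps
  that term in the shape of the harmonic lemmas.\<close>

lemma support_at_eq: "support_at c \<gamma> = (\<lambda>x. support \<gamma> x - Re (cnj c * cis (real 1 * x)))"
  by (simp add: support_at_def inner_complex_def algebra_simps fun_eq_iff)

lemma cont_periodic_support_at:
  assumes "hedgehog \<gamma>"
  shows "cont_periodic (support_at c \<gamma>)"
proof -
  have "cont_periodic (support \<gamma>)"
    using support_continuous[OF assms] support_periodic[OF assms] by (intro cont_periodicI)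
  then show ?thesis
    unfolding support_at_eq[of c] by (rule cont_periodic_diff[OF _ cont_periodic_harmonic])
qed

lemma fourier_coeff_support_at:
  assumes "hedgehog \<gamma>"
  shows "fourier_coeff (support_at c \<gamma>) n = fourier_coeff (support \<gamma>) n - (if n = 1 then of_real pi * cnj c else 0)"
  unfolding support_at_eq[of c]
    fourier_coeff_diff[OF cont_periodic_support_at[OF assms] cont_periodic_harmonic]
    fourier_coeff_harmonic[OF zero_less_one] ..

lemma fourier_coeff_support_0:
  assumes "hedgehog \<gamma>"
  shows "fourier_coeff (support \<gamma>) 0 = of_real (signed_length \<gamma>)"
proof -
  have "(support \<gamma>) integrable_on {0..2 * pi}"
    by (rule cont_periodic_integrable[OF cont_periodic_support_at[OF assms]])
  from integral_linear[OF this bounded_linear_of_real[where 'a = complex]] show ?thesis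
    by (simp add: fourier_coeff_def signed_length_def scaleR_conv_of_real o_def)
qed

text \<open>The conjugate appears because coefficients integrate against cis(-x), the Steiner point
  against cis x. Hence the Steiner point is the origin that removes order 1.\<close>

lemma fourier_coeff_support_1:
  assumes "hedgehog \<gamma>"
  shows "fourier_coeff (support \<gamma>) 1 = of_real pi * cnj (steiner_point \<gamma>)"
proof -
  have "(\<lambda>x. support \<gamma> x *\<^sub>R cis (1 * x)) integrable_on {0..2 * pi}"
    by (intro cont_periodic_integrable cont_periodic_scaleR cont_periodic_support_at[OF assms]
          cont_periodic_cis) auto
  from integral_linear[OF this bounded_linear_cnj] show ?thesis
    by (simp add: fourier_coeff_def steiner_point_def o_def cis_cnj scaleR_conv_of_real)
qed

lemma support_at_has_derivative:
  assumes "hedgehog \<gamma>"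
  shows "(support_at c \<gamma> has_real_derivative (\<gamma> x - c) \<bullet> cis (x + pi / 2)) (at x)"
proof -
  have "((\<lambda>x. Re (cnj c * cis (real 1 * x + 0))) has_real_derivative c \<bullet> cis (x + pi / 2)) (at x)"
    using harmonic_has_derivative[of "cnj c" 1 0 x] by (simp only: inner_cis_Re) simp
  from DERIV_diff[OF support_has_derivative[OF assms] this] show ?thesis
    unfolding support_at_eq[of c] by (simp only: inner_diff_left add_0_right)
qed

text \<open>The support function and its derivative are the two coordinates of the curve point in
  the rotating frame; both vanish.\<close>

lemma is_point_if_support_at_eq_0:
  assumes "hedgehog \<gamma>" "\<And>x. support_at c \<gamma> x = 0"
  shows "is_point \<gamma>"
proof -
  have "\<gamma> x = c" for x
  proof -
    have "support_at c \<gamma> = (\<lambda>x. 0)" using assms(2) by blast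
    with support_at_has_derivative[OF assms(1), of c x]
    have "(\<gamma> x - c) \<bullet> cis (x + pi / 2) = 0"
      using DERIV_unique[OF _ DERIV_const] by metis
    moreover have "(\<gamma> x - c) \<bullet> cis x = 0"
      using assms(2)[of x] by (simp add: support_at_def)
    ultimately show ?thesis using cis_decomp[of "\<gamma> x - c" x] by simp
  qed
  then show ?thesis unfolding is_point_def by blast
qed

section \<open>Support functions of iterated evolvents\<close>

lemma evolvent_zero_length:
  assumes "\<gamma> \<in> zero_length_hedgehogs"
  shows "evolvent \<gamma> \<in> zero_length_hedgehogs"
    and "support \<gamma> (x + pi / 2) = evolvent \<gamma> x \<bullet> cis (x + pi / 2)"
proof -
  have "is_involute (evolvent \<gamma>) \<gamma> \<and> signed_length (evolvent \<gamma>) = 0"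
    unfolding evolvent_def by (rule theI'[OF ex1_evolvent])
      (use assms in \<open>auto simp: zero_length_hedgehogs_def\<close>)
  then show "evolvent \<gamma> \<in> zero_length_hedgehogs"
    "support \<gamma> (x + pi / 2) = evolvent \<gamma> x \<bullet> cis (x + pi / 2)"
    unfolding is_involute_def is_evolute_iff zero_length_hedgehogs_def by blast+
qed

text \<open>At order 1 the factor \<i> from differentiation equals the factor cis(pi / 2) from the
  shift.\<close>

lemma steiner_point_evolvent:
  assumes "\<gamma> \<in> zero_length_hedgehogs"
  shows "steiner_point (evolvent \<gamma>) = steiner_point \<gamma>"
proof -
  have h: "hedgehog \<gamma>" "hedgehog (evolvent \<gamma>)"
    using assms evolvent_zero_length(1)[OF assms] by (auto simp: zero_length_hedgehogs_def)
  have "fourier_coeff (\<lambda>x. support \<gamma> (x + pi / 2)) 1 = \<i> * of_nat 1 * fourier_coeff (support (evolvent \<gamma>)) 1"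
  proof (rule fourier_coeff_derivative)
    show "(support (evolvent \<gamma>) has_real_derivative support \<gamma> (x + pi / 2)) (at x)" for x
      unfolding evolvent_zero_length(2)[OF assms] by (rule support_has_derivative[OF h(2)])
  qed (intro support_periodic h cont_periodic_shift cont_periodic_support_at)+
  then show ?thesis
    by (simp add: fourier_coeff_shift[OF cont_periodic_support_at[OF h(1)]]
        fourier_coeff_support_1[OF h(1), simplified] fourier_coeff_support_1[OF h(2), simplified])
qed

lemma evolvents_zero_length:
  "\<gamma> \<in> zero_length_hedgehogs \<Longrightarrow> (evolvent ^^ k) \<gamma> \<in> zero_length_hedgehogs"
  by (induction k) (auto intro: evolvent_zero_length)

lemma steiner_point_evolvents:
  "\<gamma> \<in> zero_length_hedgehogs \<Longrightarrow> steiner_point ((evolvent ^^ k) \<gamma>) = steiner_point \<gamma>"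
  by (induction k) (auto simp: steiner_point_evolvent evolvents_zero_length)

text \<open>The origin is fixed once for all k, which is legitimate because the evolvents share
  their Steiner point.\<close>

definition evolvent_supports :: "(real \<Rightarrow> complex) \<Rightarrow> nat \<Rightarrow> real \<Rightarrow> real" where
  "evolvent_supports \<gamma> k = support_at (steiner_point \<gamma>) ((evolvent ^^ k) \<gamma>)"

text \<open>The tangential coordinate of an evolvent is the preceding support function. This yields
  the recursion and also lets convergence of supports control the curve points.\<close>

lemma evolvent_supports_Suc:
  assumes "\<gamma> \<in> zero_length_hedgehogs"
  shows "evolvent_supports \<gamma> k (x + pi / 2) =
    ((evolvent ^^ Suc k) \<gamma> x - steiner_point \<gamma>) \<bullet> cis (x + pi / 2)"
  using evolvent_zero_length(2)[OF evolvents_zero_length[OF assms], of k x]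
  by (simp add: evolvent_supports_def support_at_def inner_diff_left)

lemma evolvent_seq_supports:
  assumes "\<gamma> \<in> zero_length_hedgehogs"
  shows "evolvent_seq (evolvent_supports \<gamma>)"
proof
  have h: "hedgehog ((evolvent ^^ k) \<gamma>)" for k
    using evolvents_zero_length[OF assms, of k] by (simp add: zero_length_hedgehogs_def)
  show "cont_periodic (evolvent_supports \<gamma> k)" for k
    unfolding evolvent_supports_def by (rule cont_periodic_support_at[OF h])
  show "(evolvent_supports \<gamma> (Suc k) has_real_derivative evolvent_supports \<gamma> k (x + pi / 2)) (at x)" for k x
    unfolding evolvent_supports_Suc[OF assms]
    unfolding evolvent_supports_def by (rule support_at_has_derivative[OF h])
qed

lemma fourier_coeff_evolvent_supports:
  assumes "\<gamma> \<in> zero_length_hedgehogs"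
  shows "fourier_coeff (evolvent_supports \<gamma> 0) n = (if n \<le> 1 then 0 else fourier_coeff (support \<gamma>) n)"
proof -
  have h: "hedgehog \<gamma>" "signed_length \<gamma> = 0"
    using assms by (auto simp: zero_length_hedgehogs_def)
  have "fourier_coeff (evolvent_supports \<gamma> 0) n =
      fourier_coeff (support \<gamma>) n - (if n = 1 then of_real pi * cnj (steiner_point \<gamma>) else 0)"
    unfolding evolvent_supports_def funpow_0 by (rule fourier_coeff_support_at[OF h(1)])
  moreover have "n = 0 \<or> n = 1 \<or> n > 1" by auto
  ultimately show ?thesis
    using fourier_coeff_support_0[OF h(1)] fourier_coeff_support_1[OF h(1)] h(2) by auto
qed

lemma limiting_shape_iff:
  assumes "\<gamma> \<in> zero_length_hedgehogs"
  shows "limiting_shape (\<lambda>k. (evolvent ^^ k) \<gamma>) \<delta> \<longleftrightarrow> hedgehog \<delta> \<and> \<not> is_point \<delta> \<and>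
     (\<exists>c \<theta> :: nat \<Rightarrow> real. (\<forall>k. c k \<noteq> 0) \<and>
        (\<forall>j. uniform_limit UNIV
           (\<lambda>k. (deriv ^^ j) (\<lambda>\<alpha>. c k * evolvent_supports \<gamma> k (\<alpha> + \<theta> k)))
           ((deriv ^^ j) (support_at (steiner_point \<delta>) \<delta>)) sequentially))"
  unfolding limiting_shape_def evolvent_supports_def steiner_point_evolvents[OF assms] ..

lemma evolvents_converge:
  assumes "\<gamma> \<in> zero_length_hedgehogs"
  shows "uniform_limit UNIV (\<lambda>k. (evolvent ^^ k) \<gamma>) (\<lambda>_. steiner_point \<gamma>) sequentially"
proof (rule uniform_limitI)
  interpret evolvent_seq "evolvent_supports \<gamma>"
    by (rule evolvent_seq_supports[OF assms])
  let ?s = "steiner_point \<gamma>" and ?f = "evolvent_supports \<gamma>"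
  have "fourier_coeff (?f 0) n = 0" if "n \<le> 1" for n
    using fourier_coeff_evolvent_supports[OF assms, of n] that by simp
  \<comment> \<open>For m = 1 the rescaling factor is 1, the phase is 0, and the limiting harmonic
    vanishes, leaving plain uniform convergence to 0.\<close>
  with rescaled_limit[of 1 0]
  have lim: "uniform_limit UNIV ?f (\<lambda>x. 0) sequentially"
    by (simp add: phase_def)
  fix e :: real assume "e > 0"
  then have "\<forall>\<^sub>F k in sequentially. \<forall>x\<in>UNIV. dist (?f k x) 0 < e / 2"
    using uniform_limitD[OF lim, of "e / 2"] by simp
  then obtain K where K: "\<And>k x. k \<ge> K \<Longrightarrow> \<bar>?f k x\<bar> < e / 2"
    unfolding eventually_sequentially by auto
  have "dist ((evolvent ^^ k) \<gamma> x) ?s < e" if k: "k \<ge> Suc K" for k x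
  proof -
    \<comment> \<open>The tangential coordinate lives at the preceding index, hence the threshold
      \<open>Suc K\<close>; each of the two coordinates gets e / 2.\<close>
    obtain i where i: "k = Suc i" "i \<ge> K" using k by (cases k) auto
    define z where "z = (evolvent ^^ k) \<gamma> x - ?s"
    have z1: "z \<bullet> cis x = ?f k x"
      unfolding z_def evolvent_supports_def support_at_def ..
    have z2: "z \<bullet> cis (x + pi / 2) = ?f i (x + pi / 2)"
      unfolding z_def i(1) evolvent_supports_Suc[OF assms] ..
    have "norm z = norm (?f k x *\<^sub>R cis x + ?f i (x + pi / 2) *\<^sub>R cis (x + pi / 2))"
      using cis_decomp[of z x] unfolding z1 z2 by (rule arg_cong)
    also have "\<dots> \<le> \<bar>?f k x\<bar> + \<bar>?f i (x + pi / 2)\<bar>"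
      by (rule norm_triangle_le) simp
    also have "\<dots> < e"
      using K[of k x] K[of i "x + pi / 2"] i by simp
    finally show ?thesis by (simp add: dist_norm z_def)
  qed
  then show "\<forall>\<^sub>F k in sequentially. \<forall>x\<in>UNIV. dist ((evolvent ^^ k) \<gamma> x) ?s < e"
    unfolding eventually_sequentially by blast
qed

section \<open>Hedgehogs whose support function is a pure harmonic\<close>

definition harmonic_curve :: "complex \<Rightarrow> nat \<Rightarrow> real \<Rightarrow> complex" where
  "harmonic_curve a m x = Re (a * cis (real m * x)) *\<^sub>R cis x
     + (real m * Re (a * cis (real m * x + pi / 2))) *\<^sub>R cis (x + pi / 2)"

text \<open>A hedgehog with smooth support p moves along its tangent with velocity p + p'', and here
  p'' = -m^2 p.\<close>

lemma harmonic_curve_has_derivative: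
  "(harmonic_curve a m has_vector_derivative
     ((1 - real m ^ 2) * Re (a * cis (real m * x))) *\<^sub>R cis (x + pi / 2)) (at x)"
proof -
  have "cis (y + (pi / 2 + pi / 2)) = - cis y" for y
    by (simp add: minus_cis)
  then have "real m * (real m * Re (a * cis (real m * x + (pi / 2 + pi / 2)))) =
      - (real m ^ 2 * Re (a * cis (real m * x)))"
    by (simp add: power2_eq_square algebra_simps)
  then have h: "((\<lambda>x. Re (a * cis (real m * x))) has_real_derivative
      real m * Re (a * cis (real m * x + pi / 2))) (at x)"
    "((\<lambda>x. real m * Re (a * cis (real m * x + pi / 2))) has_real_derivative
      - (real m ^ 2 * Re (a * cis (real m * x)))) (at x)"
    using harmonic_has_derivative[of a m 0 x]
      DERIV_cmult[OF harmonic_has_derivative[of a m "pi / 2" x], of "real m"]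
    by (simp_all only: add_0_left add_0_right)
  have c: "((\<lambda>x. cis (x + t)) has_vector_derivative cis (x + t + pi / 2)) (at x)" for t
    by (auto simp: has_vector_derivative_complex_iff cos_add sin_add intro!: derivative_eq_intros)
  have "cis (x + pi / 2 + pi / 2) = - cis x"
    by (simp add: minus_cis add.assoc)
  then show ?thesis
    using has_vector_derivative_add[OF has_vector_derivative_scaleR[OF h(1) c[of 0]]
        has_vector_derivative_scaleR[OF h(2) c[of "pi / 2"]]]
    unfolding harmonic_curve_def[abs_def]
    by (simp add: algebra_simps del: times_complex.sel)
qed

lemma inner_cis_cis: "cis x \<bullet> cis x = 1" "cis (x + pi / 2) \<bullet> cis x = 0"
  by (simp_all add: inner_complex_def sin_add cos_add flip: power2_eq_square)

lemma support_harmonic_curve: "support (harmonic_curve a m) = (\<lambda>x. Re (a * cis (real m * x)))"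
  unfolding support_at_def harmonic_curve_def
  by (simp add: inner_add_left inner_cis_cis del: times_complex.sel)

text \<open>Supplies the perturbations for density and, starting from the constant curve 0, the
  hypocycloids themselves.\<close>

lemma hedgehog_add_harmonic:
  assumes "hedgehog \<gamma>"
  shows "hedgehog (\<lambda>x. \<gamma> x + harmonic_curve a m x)"
  unfolding hedgehog_def
proof (intro conjI allI impI)
  let ?D = "\<lambda>x. ((1 - real m ^ 2) * Re (a * cis (real m * x))) *\<^sub>R cis (x + pi / 2)"
  note D = harmonic_curve_has_derivative[of a m]
  have 1: "cis (real m * (x + 2 * pi)) = cis (real m * x)" for x
    using cont_periodic_eq[OF cont_periodic_cis[of "real m"], of x] by simp
  have 2: "cis (x + 2 * pi + pi / 2) = cis (x + pi / 2)" "cis (x + 2 * pi) = cis x" for x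
    by (simp_all only: cis_mult[symmetric] cis_2pi mult_1_right)
  have "harmonic_curve a m (x + 2 * pi) = harmonic_curve a m x" for x
    unfolding harmonic_curve_def cis_mult[of "real m * _", symmetric] 1 2 ..
  then show "\<gamma> (x + 2 * pi) + harmonic_curve a m (x + 2 * pi) = \<gamma> x + harmonic_curve a m x" for x
    using hedgehog_periodic[OF assms] by simp
  have "harmonic_curve a m C1_differentiable_on {0..2 * pi}"
    unfolding C1_differentiable_on_def
    by (intro exI[of _ ?D] conjI ballI D continuous_intros)
  then show "(\<lambda>x. \<gamma> x + harmonic_curve a m x) piecewise_C1_differentiable_on {0..2 * pi}"
    using assms unfolding hedgehog_def
    by (blast intro: piecewise_C1_differentiable_add C1_differentiable_imp_piecewise)
  fix x assume diff: "(\<lambda>x. \<gamma> x + harmonic_curve a m x) differentiable (at x)"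
  have "harmonic_curve a m differentiable (at x)"
    using D[of x] by (auto simp: has_vector_derivative_def differentiable_def)
  \<comment> \<open>The tangency condition for \<gamma> is available only where \<gamma> is
    differentiable; subtracting the smooth summand shows that this holds at x.\<close>
  from differentiable_diff[OF diff this] have d: "\<gamma> differentiable (at x)"
    by simp
  then have "vector_derivative (\<lambda>x. \<gamma> x + harmonic_curve a m x) (at x) = vector_derivative \<gamma> (at x) + ?D x"
    by (intro vector_derivative_at has_vector_derivative_add D)
      (simp add: vector_derivative_works)
  then show "vector_derivative (\<lambda>x. \<gamma> x + harmonic_curve a m x) (at x) \<bullet> cis x = 0"
    using assms d by (simp add: hedgehog_def inner_add_left inner_cis_cis)
qed

lemma hedgehog_harmonic_curve: "hedgehog (harmonic_curve a m)"
proof -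
  have "hedgehog (\<lambda>x. 0)"
    by (simp add: hedgehog_def C1_differentiable_imp_piecewise)
  from hedgehog_add_harmonic[OF this] show ?thesis by simp
qed

lemma steiner_point_harmonic_curve:
  assumes "m \<ge> 2"
  shows "steiner_point (harmonic_curve a m) = 0"
proof -
  have "fourier_coeff (support (harmonic_curve a m)) 1 = 0"
    unfolding support_harmonic_curve using assms by (subst fourier_coeff_harmonic) auto
  then show ?thesis
    using fourier_coeff_support_1[OF hedgehog_harmonic_curve, of a m] by simp
qed

section \<open>The order of the limiting shape\<close>

lemma harmonic_eq: "Re (a * cis x) = Re a * cos x + (- Im a) * sin x"
  by simp

lemma evolvents_limit_orderI:
  assumes \<gamma>: "\<gamma> \<in> zero_length_hedgehogs" and m: "m \<ge> 2"
    and zero: "\<And>n. n < m \<Longrightarrow> fourier_coeff (evolvent_supports \<gamma> 0) n = 0"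
    and nz: "fourier_coeff (evolvent_supports \<gamma> 0) m \<noteq> 0"
  shows "evolvents_limit_order m \<gamma>"
  unfolding evolvents_limit_order_def limiting_shape_iff[OF \<gamma>]
proof (intro conjI allI impI)
  interpret evolvent_seq "evolvent_supports \<gamma>"
    by (rule evolvent_seq_supports[OF \<gamma>])
  have m0: "m > 0" using m by simp
  define a where "a = fourier_coeff (evolvent_supports \<gamma> 0) m / of_real pi"
  define \<delta> where "\<delta> = harmonic_curve a m"
  have supp: "support_at (steiner_point \<delta>) \<delta> = (\<lambda>x. Re (a * cis (real m * x)))"
    unfolding \<delta>_def steiner_point_harmonic_curve[OF m] support_harmonic_curve ..
  show "\<exists>\<delta>. hedgehog \<delta> \<and> \<not> is_point \<delta> \<and>
     (\<exists>c \<theta> :: nat \<Rightarrow> real. (\<forall>k. c k \<noteq> 0) \<and>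
        (\<forall>j. uniform_limit UNIV
           (\<lambda>k. (deriv ^^ j) (\<lambda>\<alpha>. c k * evolvent_supports \<gamma> k (\<alpha> + \<theta> k)))
           ((deriv ^^ j) (support_at (steiner_point \<delta>) \<delta>)) sequentially))"
  proof (intro exI conjI allI)
    show "hedgehog \<delta>" unfolding \<delta>_def by (rule hedgehog_harmonic_curve)
    show "\<not> is_point \<delta>"
    \<comment> \<open>A constant curve has a support function of pure order 1, while that of
      \<delta> has a non-zero coefficient of order m \<ge> 2.\<close>
    proof
      assume "is_point \<delta>"
      then obtain c where "\<delta> = (\<lambda>x. c)" unfolding is_point_def by blast
      then have "support \<delta> = (\<lambda>x. Re (cnj c * cis (real 1 * x)))"
        unfolding support_at_def inner_cis_Re by simp
      then have "fourier_coeff (support \<delta>) m = 0"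
        using m fourier_coeff_harmonic[of 1 "cnj c" m] by simp
      moreover have "fourier_coeff (support \<delta>) m = of_real pi * a"
        unfolding \<delta>_def support_harmonic_curve fourier_coeff_harmonic[OF m0] by simp
      ultimately show False using nz by (simp add: a_def)
    qed
    show "real m ^ k \<noteq> 0" for k using m by simp
    show "uniform_limit UNIV
        (\<lambda>k. (deriv ^^ j) (\<lambda>\<alpha>. real m ^ k * evolvent_supports \<gamma> k (\<alpha> + phase m k)))
        ((deriv ^^ j) (support_at (steiner_point \<delta>) \<delta>)) sequentially" for j
      unfolding supp a_def by (rule rescaled_limit[OF m0 zero])
  qed
  fix \<delta> assume "hedgehog \<delta> \<and> \<not> is_point \<delta> \<and>
     (\<exists>c \<theta> :: nat \<Rightarrow> real. (\<forall>k. c k \<noteq> 0) \<and>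
        (\<forall>j. uniform_limit UNIV
           (\<lambda>k. (deriv ^^ j) (\<lambda>\<alpha>. c k * evolvent_supports \<gamma> k (\<alpha> + \<theta> k)))
           ((deriv ^^ j) (support_at (steiner_point \<delta>) \<delta>)) sequentially))"
  then obtain c \<theta> where h: "hedgehog \<delta>" "\<not> is_point \<delta>"
    and "\<And>j. uniform_limit UNIV
           (\<lambda>k. (deriv ^^ j) (\<lambda>\<alpha>. c k * evolvent_supports \<gamma> k (\<alpha> + \<theta> k)))
           ((deriv ^^ j) (support_at (steiner_point \<delta>) \<delta>)) sequentially"
    by blast
  from this(3)[of 0] have lim: "uniform_limit UNIV (\<lambda>k \<alpha>. c k * evolvent_supports \<gamma> k (\<alpha> + \<theta> k))
      (support_at (steiner_point \<delta>) \<delta>) sequentially"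
    by simp
  define b where "b = fourier_coeff (support_at (steiner_point \<delta>) \<delta>) m / of_real pi"
  have g: "support_at (steiner_point \<delta>) \<delta> x = Re (b * cis (real m * x))" for x
    unfolding b_def by (rule uniform_limit_harmonic[OF lim m0 zero nz])
  \<comment> \<open>Factors that grow too slowly would give the limit 0; demanding that \<delta> is
    not a point excludes this.\<close>
  have "b \<noteq> 0"
    using is_point_if_support_at_eq_0[OF h(1)] h(2) g by fastforce
  then have "(Re b, - Im b) \<noteq> (0, 0)" by (auto simp: complex_eq_iff)
  then show "hypocycloid m \<delta>"
    unfolding hypocycloid_def using h(1) g unfolding harmonic_eq by blast
qed

lemma evolvents_limit_order_exists:
  assumes \<gamma>: "\<gamma> \<in> zero_length_hedgehogs" and np: "\<not> is_point \<gamma>"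
  shows "\<exists>m\<ge>2. evolvents_limit_order m \<gamma>"
proof -
  interpret evolvent_seq "evolvent_supports \<gamma>"
    by (rule evolvent_seq_supports[OF \<gamma>])
  let ?c = "fourier_coeff (evolvent_supports \<gamma> 0)"
  have "\<exists>n. ?c n \<noteq> 0"
  proof (rule ccontr)
    assume "\<not> ?thesis"
    then have "evolvent_supports \<gamma> 0 x = 0" for x
      by (intro fourier_unique cont_periodic) auto
    then have "is_point \<gamma>"
      using \<gamma> by (intro is_point_if_support_at_eq_0[of _ "steiner_point \<gamma>"])
        (auto simp: evolvent_supports_def zero_length_hedgehogs_def)
    with np show False ..
  qed
  define m where "m = (LEAST n. ?c n \<noteq> 0)"
  have nz: "?c m \<noteq> 0" unfolding m_def by (rule LeastI_ex) fact
  have "?c n = 0" if "n < m" for n using not_less_Least that unfolding m_def by blast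
  \<comment> \<open>Orders 0 and 1 are absent by zero signed length and by the choice of
    origin.\<close>
  moreover have "m \<ge> 2"
    using nz fourier_coeff_evolvent_supports[OF \<gamma>, of m] by (cases "m \<le> 1") auto
  ultimately show ?thesis using evolvents_limit_orderI[OF \<gamma>] nz by blast
qed

text \<open>For the converse, an order 2 harmonic absent from \<gamma> is absent from all rescaled
  evolvents, hence from any limit.\<close>

lemma evolvents_limit_order_2_iff:
  assumes \<gamma>: "\<gamma> \<in> zero_length_hedgehogs"
  shows "evolvents_limit_order 2 \<gamma> \<longleftrightarrow> fourier_coeff (support \<gamma>) 2 \<noteq> 0"
proof
  assume "fourier_coeff (support \<gamma>) 2 \<noteq> 0"
  then show "evolvents_limit_order 2 \<gamma>"
    using fourier_coeff_evolvent_supports[OF \<gamma>] by (intro evolvents_limit_orderI[OF \<gamma>]) auto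
next
  interpret evolvent_seq "evolvent_supports \<gamma>"
    by (rule evolvent_seq_supports[OF \<gamma>])
  assume "evolvents_limit_order 2 \<gamma>"
  then obtain \<delta> where \<delta>: "limiting_shape (\<lambda>k. (evolvent ^^ k) \<gamma>) \<delta>" "hypocycloid 2 \<delta>"
    unfolding evolvents_limit_order_def by blast
  then have h: "hedgehog \<delta>" by (simp add: hypocycloid_def)
  obtain a \<theta> where "\<And>j. uniform_limit UNIV
           (\<lambda>k. (deriv ^^ j) (\<lambda>\<alpha>. a k * evolvent_supports \<gamma> k (\<alpha> + \<theta> k)))
           ((deriv ^^ j) (support_at (steiner_point \<delta>) \<delta>)) sequentially"
    using \<delta>(1) unfolding limiting_shape_iff[OF \<gamma>] by blast
  from this[of 0] have lim: "uniform_limit UNIV (\<lambda>k \<alpha>. a k * evolvent_supports \<gamma> k (\<alpha> + \<theta> k))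
      (support_at (steiner_point \<delta>) \<delta>) sequentially"
    by simp
  obtain c p q where pq: "(p, q) \<noteq> (0, 0)"
    "\<And>x. support_at c \<delta> x = p * cos (real 2 * x) + q * sin (real 2 * x)"
    using \<delta>(2) unfolding hypocycloid_def by blast
  have "support_at c \<delta> = (\<lambda>x. Re (Complex p (- q) * cis (real 2 * x)))"
    using pq(2) by auto
  then have "fourier_coeff (support_at c \<delta>) 2 = of_real pi * Complex p (- q)"
    using fourier_coeff_harmonic[of 2 "Complex p (- q)" 2] by simp
  also have "\<dots> \<noteq> 0" using pq(1) by (auto simp: complex_eq_iff)
  \<comment> \<open>The centre c of the hypocycloid need not be known to be the Steiner point: order
    2 does not depend on the origin.\<close>
  finally have "fourier_coeff (support_at (steiner_point \<delta>) \<delta>) 2 \<noteq> 0"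
    using fourier_coeff_support_at[OF h, of c 2] fourier_coeff_support_at[OF h, of "steiner_point \<delta>" 2]
    by simp
  moreover have "fourier_coeff (support_at (steiner_point \<delta>) \<delta>) 2 = 0"
    if "fourier_coeff (support \<gamma>) 2 = 0"
  proof -
    have "(\<lambda>k. 0) \<longlonglongrightarrow> norm (fourier_coeff (support_at (steiner_point \<delta>) \<delta>) 2)"
      using uniform_limit_fourier_coeff_norm[OF lim, of 2] that
        fourier_coeff_evolvent_supports[OF \<gamma>, of 2] by simp
    from LIMSEQ_unique[OF tendsto_const this] show ?thesis by simp
  qed
  ultimately show "fourier_coeff (support \<gamma>) 2 \<noteq> 0" by blast
qed

section \<open>Openness and density of order 2\<close>

lemma support_add_harmonic:
  "support (\<lambda>x. \<gamma> x + harmonic_curve a m x) = (\<lambda>x. support \<gamma> x + Re (a * cis (real m * x)))"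
  using fun_cong[OF support_harmonic_curve[of a m]]
  by (simp add: fun_eq_iff support_at_def inner_add_left del: times_complex.sel)

lemma generically_limit_order_2: "generically (evolvents_limit_order 2)"
  unfolding generically_def
proof (intro conjI ballI allI impI)
  fix \<gamma> assume \<gamma>: "\<gamma> \<in> zero_length_hedgehogs" and "evolvents_limit_order 2 \<gamma>"
  then have nz: "fourier_coeff (support \<gamma>) 2 \<noteq> 0"
    by (simp add: evolvents_limit_order_2_iff)
  \<comment> \<open>A uniform change below \<epsilon> moves the coefficient by at most 2 pi
    \<epsilon>, half of its norm.\<close>
  define \<epsilon> where "\<epsilon> = norm (fourier_coeff (support \<gamma>) 2) / (4 * pi)"
  have "evolvents_limit_order 2 \<gamma>'"
    if \<gamma>': "\<gamma>' \<in> zero_length_hedgehogs" and close: "\<forall>\<alpha>. \<bar>support \<gamma>' \<alpha> - support \<gamma> \<alpha>\<bar> < \<epsilon>" for \<gamma>'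
  proof -
    have p: "cont_periodic (support \<gamma>')" "cont_periodic (support \<gamma>)"
      using \<gamma> \<gamma>' by (auto simp: zero_length_hedgehogs_def intro: cont_periodic_support_at)
    have "norm (fourier_coeff (\<lambda>x. support \<gamma>' x - support \<gamma> x) 2) \<le> \<epsilon> * (2 * pi)"
      using close by (intro norm_fourier_coeff_le cont_periodic_diff p) (auto intro: less_imp_le)
    also have "\<dots> < norm (fourier_coeff (support \<gamma>) 2)"
      using nz by (simp add: \<epsilon>_def)
    finally have "fourier_coeff (support \<gamma>') 2 \<noteq> 0"
      unfolding fourier_coeff_diff[OF p] by auto
    then show ?thesis using \<gamma>' by (simp add: evolvents_limit_order_2_iff)
  qed
  moreover have "\<epsilon> > 0" using nz by (simp add: \<epsilon>_def)
  ultimately show "\<exists>\<epsilon>>0. \<forall>\<gamma>'\<in>zero_length_hedgehogs.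
      (\<forall>\<alpha>. \<bar>support \<gamma>' \<alpha> - support \<gamma> \<alpha>\<bar> < \<epsilon>) \<longrightarrow> evolvents_limit_order 2 \<gamma>'"
    by blast
next
  fix \<gamma> and r :: nat and \<epsilon> :: real
  assume \<gamma>: "\<gamma> \<in> zero_length_hedgehogs" and \<epsilon>: "\<epsilon> > 0"
  then have h: "hedgehog \<gamma>" by (simp add: zero_length_hedgehogs_def)
  \<comment> \<open>A perturbation is made only if the coefficient vanishes. Derivatives of order up
    to r enlarge an order 2 harmonic by at most 2^r, so this size keeps them within \<epsilon> /
    2.\<close>
  obtain \<eta> :: real where \<eta>: "0 \<le> \<eta>" "\<eta> \<le> \<epsilon> / 2 ^ Suc r"
    "fourier_coeff (support \<gamma>) 2 + of_real pi * of_real \<eta> \<noteq> 0"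
  proof (cases "fourier_coeff (support \<gamma>) 2 = 0")
    case True
    then show thesis using that[of "\<epsilon> / 2 ^ Suc r"] \<epsilon> by simp
  next
    case False
    then show thesis using that[of 0] \<epsilon> by simp
  qed
  define \<gamma>' where "\<gamma>' = (\<lambda>x. \<gamma> x + harmonic_curve (of_real \<eta>) 2 x)"
  have h': "hedgehog \<gamma>'"
    unfolding \<gamma>'_def by (rule hedgehog_add_harmonic[OF h])
  have coeff: "fourier_coeff (support \<gamma>') n =
      fourier_coeff (support \<gamma>) n + (if n = 2 then of_real pi * of_real \<eta> else 0)" for n
    unfolding \<gamma>'_def support_add_harmonic
      fourier_coeff_add[OF cont_periodic_support_at[OF h] cont_periodic_harmonic]
    by (subst fourier_coeff_harmonic) simp_all
  \<comment> \<open>The added harmonic has order 2, so the order 0 coefficient, the signed length,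
    stays zero.\<close>
  have \<gamma>'0: "\<gamma>' \<in> zero_length_hedgehogs"
    using coeff[of 0] \<gamma> h' fourier_coeff_support_0[OF h] fourier_coeff_support_0[OF h']
    by (simp add: zero_length_hedgehogs_def)
  have diff: "(deriv ^^ j) (\<lambda>\<alpha>. support \<gamma>' \<alpha> - support \<gamma> \<alpha>) =
      (\<lambda>x. 2 ^ j * Re (of_real \<eta> * cis (real 2 * x + real j * (pi / 2))))" for j
    using deriv_harmonic[of j "of_real \<eta>" 2]
    unfolding \<gamma>'_def support_add_harmonic by simp
  show "\<exists>\<gamma>'\<in>zero_length_hedgehogs. evolvents_limit_order 2 \<gamma>' \<and>
        (\<forall>j. (deriv ^^ j) (\<lambda>\<alpha>. support \<gamma>' \<alpha> - support \<gamma> \<alpha>) differentiable_on UNIV) \<and>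
        (\<forall>j\<le>r. \<forall>\<alpha>. \<bar>(deriv ^^ j) (\<lambda>\<alpha>. support \<gamma>' \<alpha> - support \<gamma> \<alpha>) \<alpha>\<bar> < \<epsilon>)"
  proof (intro bexI[OF _ \<gamma>'0] conjI allI impI)
    show "evolvents_limit_order 2 \<gamma>'"
      using evolvents_limit_order_2_iff[OF \<gamma>'0] coeff[of 2] \<eta>(3) by simp
    show "(deriv ^^ j) (\<lambda>\<alpha>. support \<gamma>' \<alpha> - support \<gamma> \<alpha>) differentiable_on UNIV" for j
      unfolding diff
      by (intro differentiable_at_imp_differentiable_on)
        (use DERIV_cmult[OF harmonic_has_derivative[of "of_real \<eta>" 2 "real j * (pi / 2)"], of "2 ^ j"]
          in \<open>unfold real_differentiable_def, blast\<close>)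
    fix j x assume j: "j \<le> r"
    have "\<bar>(deriv ^^ j) (\<lambda>\<alpha>. support \<gamma>' \<alpha> - support \<gamma> \<alpha>) x\<bar> =
        2 ^ j * (\<eta> * \<bar>cos (real 2 * x + real j * (pi / 2))\<bar>)"
      unfolding diff using \<eta>(1) by (simp add: abs_mult)
    also have "\<dots> \<le> 2 ^ r * (\<epsilon> / 2 ^ Suc r * 1)"
      using \<eta> j by (intro mult_mono power_increasing) auto
    also have "\<dots> < \<epsilon>" using \<epsilon> by simp
    finally show "\<bar>(deriv ^^ j) (\<lambda>\<alpha>. support \<gamma>' \<alpha> - support \<gamma> \<alpha>) x\<bar> < \<epsilon>" .
  qed
qed

theorem theorem2:
  "(\<forall>\<gamma>. hedgehog \<gamma> \<and> signed_length \<gamma> = 0 \<longrightarrow>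
      uniform_limit UNIV (\<lambda>k. (evolvent ^^ k) \<gamma>) (\<lambda>_. steiner_point \<gamma>) sequentially \<and>
      (\<not> is_point \<gamma> \<longrightarrow> (\<exists>m\<ge>2. evolvents_limit_order m \<gamma>))) \<and>
   generically (evolvents_limit_order 2)"
proof (intro conjI allI impI)
  show "generically (evolvents_limit_order 2)"
    by (rule generically_limit_order_2)
  fix \<gamma> assume "hedgehog \<gamma> \<and> signed_length \<gamma> = 0"
  then have \<gamma>: "\<gamma> \<in> zero_length_hedgehogs"
    by (simp add: zero_length_hedgehogs_def)
  show "uniform_limit UNIV (\<lambda>k. (evolvent ^^ k) \<gamma>) (\<lambda>_. steiner_point \<gamma>) sequentially"
    by (rule evolvents_converge[OF \<gamma>])
  show "\<exists>m\<ge>2. evolvents_limit_order m \<gamma>" if "\<not> is_point \<gamma>"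
    by (rule evolvents_limit_order_exists[OF \<gamma> that])
qed

end
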